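(* Let $k>1$ and $s\ge 1$ be integers with $s\le\lfloor k/2\rfloor$. Then for all integers $n\ge 0$: \begin{align*} p_{-(3^{k}-6b)/b}\left(3^{2s} n+3^{2s-1} r+\frac{3^{2s}-1}{4}\right)&\equiv 0 \pmod{3^{k}}, && r\in\{1,2\},\\ p_{-(5^{k}-8b)/b}\left(5^{2s} n+5^{2s-1} r+\frac{2\cdot 5^{2s-1}-1}{3}\right)&\equiv 0 \pmod{5^{k}}, && r\in\{0,2,3,4\},\\ p_{-(5^{k}-14b)/b}\left(5^{2s} n+5^{2s-1} r+\frac{11\cdot 5^{2s-1}-7}{12}\right)&\equiv 0 \pmod{5^{k}}, && r\in\{0,1,3,4\},\\ p_{-(7^{k}-6b)/b}\left(7^{2s} n+7^{2s-1} r+\frac{3\cdot 7^{2s-1}-1}{4}\right)&\equiv 0 \pmod{7^{k}}, && r\in\{0,2,3,4,5,6\}, \end{align*} where in each congruence $b$ is any positive integer coprime to the modulus (i.e. to $3$, $5$, $5$, $7$ respectively).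
   Context: For a rational number $t\neq 0$, the rational numbers $p_t(n)$, $n\ge 0$, are defined by the formal power series identity $\sum_{n\ge 0}p_t(n)q^n=\prod_{j\ge 1}(1-q^j)^t$, where each factor $(1-q^j)^t$ is the binomial series with constant term $1$. For a prime $\ell$ not dividing the denominator of $t$, a congruence $p_t(N)\equiv 0\pmod{\ell^k}$ means that the numerator of $p_t(N)$, written as a reduced fraction, is divisible by $\ell^k$ (the denominator of $p_t(N)$ is then coprime to $\ell$). *)

theory Defs
  imports "HOL-Analysis.Analysis"
begin

text \<open>The series \<open>(1 - q^j)^t\<close>: the binomial series \<^term>\<open>fps_binomial t\<close>, which is
  \<open>(1 + X)^t\<close>, with \<open>- q^j\<close> substituted for \<open>X\<close>.\<close>

definition euler_factor_powr :: "rat \<Rightarrow> nat \<Rightarrow> rat fps" where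
  "euler_factor_powr t j = fps_compose (fps_binomial t) (- (fps_X ^ j))"

text \<open>The infinite product is taken in the \<open>q\<close>-adic topology of \<^typ>\<open>rat fps\<close>; the product
  index is shifted so that it runs over \<open>j \<ge> 1\<close>.\<close>

definition p_gen :: "rat \<Rightarrow> rat fps" where
  "p_gen t = prodinf (\<lambda>i. euler_factor_powr t (Suc i))"

definition p_frac :: "rat \<Rightarrow> nat \<Rightarrow> rat" where
  "p_frac t n = fps_nth (p_gen t) n"

text \<open>The congruence \<open>x \<equiv> 0 (mod m)\<close> for rational \<open>x\<close>: \<^const>\<open>quotient_of\<close> returns the
  numerator and the (positive) denominator in lowest terms.\<close>

definition rat_cong_0 :: "rat \<Rightarrow> int \<Rightarrow> bool" where
  "rat_cong_0 x m \<longleftrightarrow> m dvd fst (quotient_of x)"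

text \<open>Since \<^const>\<open>prodinf\<close> is a description operator, we check that the product converges.\<close>

lemma euler_factor_powr_nth_small:
  assumes "n < j"
  shows "fps_nth (euler_factor_powr t j) n = (if n = 0 then 1 else 0)"
proof -
  have X: "fps_nth ((- (fps_X ^ j)) ^ i) n = (if i = 0 \<and> n = 0 then 1 else 0 :: rat)" for i
    using assms by (cases i) (simp_all add: fps_X_power_mult_nth)
  show ?thesis
    by (simp add: euler_factor_powr_def fps_compose_nth X if_distrib[of "(*) _"]
        sum.delta cong: if_cong)
qed

lemma has_prod_p_gen: "(\<lambda>i. euler_factor_powr t (Suc i)) has_prod p_gen t"
proof -
  define f where "f i = euler_factor_powr t (Suc i)" for i
  define P where "P n = (\<Prod>i\<le>n. f i)" for n
  have step: "fps_nth (P (Suc n)) m = fps_nth (P n) m" if "m \<le> n" for m n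
  proof -
    have "fps_nth (P (Suc n)) m = (\<Sum>i=0..m. fps_nth (P n) i * fps_nth (f (Suc n)) (m - i))"
      by (simp add: P_def fps_mult_nth)
    also have "\<dots> = (\<Sum>i=0..m. if i = m then fps_nth (P n) i else 0)"
      using that by (intro sum.cong) (auto simp: f_def euler_factor_powr_nth_small)
    finally show ?thesis by simp
  qed
  have stable: "fps_nth (P n) m = fps_nth (P m) m" if "m \<le> n" for m n
    using that by (induction n rule: dec_induct) (simp_all add: step)
  define L where "L = Abs_fps (\<lambda>m. fps_nth (P m) m)"
  have "P \<longlonglongrightarrow> L"
    by (rule tendsto_fpsI) (auto simp: L_def eventually_sequentially intro: stable)
  moreover have "fps_nth L 0 = 1"
    by (simp add: L_def P_def f_def euler_factor_powr_nth_small)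
  then have "L \<noteq> 0" by auto
  ultimately have "f has_prod L"
    by (simp add: has_prod_def raw_has_prod_def P_def[abs_def])
  then show ?thesis
    using has_prod_unique unfolding p_gen_def f_def by metis
qed

end

theory Submission
  imports Defs "HOL-Computational_Algebra.Formal_Laurent_Series" "HOL-Number_Theory.Cong"
begin

text \<open>
  Let \<open>f = (\<Prod>j\<ge>1. 1 - q^j)\<close>. With \<open>t = m - p^k/b\<close> the generating function is
  \<open>f^m g^(p^k)\<close>, where \<open>g = f^(-1/b)\<close> has \<open>p\<close>-integral coefficients, so that
  \<open>g(q)^(p^k) \<equiv> g(q^p)^(p^(k-1)) (mod p^k)\<close>. In the four cases, with \<open>e = m(p^2 - 1)/24\<close>,
  the terms of \<open>f^m\<close> whose exponent is congruent to \<open>e\<close> modulo \<open>p\<close> add up to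
  \<open>l q^e f(q^(p^2))^m\<close> with \<open>p^2\<close> dividing \<open>l\<close> (the form \<open>\<eta>^m\<close> has complex multiplication by a
  field in which \<open>p\<close> is inert). Hence, modulo \<open>p^k\<close>, the coefficient of \<open>f^m g^(p^k)\<close> at such an
  exponent \<open>N\<close> vanishes unless \<open>N = p^2 M + e\<close>, and then it is \<open>l\<close> times the
  coefficient of \<open>f^m g^(p^(k-2))\<close> at \<open>M\<close>; the theorem follows by induction on \<open>s\<close>.

  For \<open>m = 6\<close> the dissection of \<open>f^m\<close> comes from Jacobi's series for \<open>f^3\<close>. For \<open>p = 5\<close>, Euler's
  pentagonal number theorem gives \<open>f = a + b + c\<close> with exponents in the classes 0, 1, 2 modulo 5
  and \<open>b = - q f(q^25)\<close>. Comparing the class of 3 in \<open>f^3\<close>, which is \<open>b^3 + 6abc\<close>, with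
  Jacobi's series yields \<open>ac = - b^2\<close>, and this relation alone reduces the relevant classes of
  \<open>f^8\<close> and \<open>f^14\<close> to multiples of \<open>b^8\<close> and \<open>b^14\<close>.
\<close>

unbundle no vec_syntax
unbundle fps_syntax

section \<open>Finite forms of the identities of Euler and Jacobi\<close>

definition tri :: "nat \<Rightarrow> nat" where "tri n = n * (n + 1) div 2"

lemma two_tri: "2 * tri n = n * (n + 1)" by (simp add: tri_def)

lemma tri_0 [simp]: "tri 0 = 0" by (simp add: tri_def)

lemma tri_Suc: "tri (Suc n) = tri n + Suc n"
proof -
  have "2 * tri (Suc n) = 2 * (tri n + Suc n)"
    unfolding two_tri distrib_left by simp
  thus ?thesis by simp
qed

lemma tri_ge: "n \<le> tri n" by (induction n) (simp_all add: tri_Suc)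

text \<open>The q-Pochhammer symbol (q;q)_n over an arbitrary commutative ring; q is later
  specialised to \<open>fps_X\<close>.\<close>

definition qfac :: "'a::comm_ring_1 \<Rightarrow> nat \<Rightarrow> 'a" where
  "qfac q n = (\<Prod>i=1..n. 1 - q ^ i)"

lemma qfac_0 [simp]: "qfac q 0 = 1" by (simp add: qfac_def)

lemma qfac_Suc: "qfac q (Suc n) = qfac q n * (1 - q ^ Suc n)" by (simp add: qfac_def)

text \<open>Shanks's finite form of the pentagonal number theorem: every summand on the left with
  \<open>k > 0\<close> is divisible by \<open>q^(n+1)\<close>, and the differences in \<open>n\<close> telescope.\<close>

lemma pentagonal_finite:
  fixes q :: "'a::comm_ring_1"
  shows "(\<Sum>k\<le>n. (-1) ^ k * (\<Prod>i=Suc k..n. 1 - q ^ i) * q ^ (k * n + tri k)) =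
    1 + (\<Sum>k<n. (-1) ^ Suc k * (q ^ (Suc k * Suc k + tri k) + q ^ (Suc k * Suc k + tri (Suc k))))"
proof (induction n)
  case (Suc n)
  define A where "A k = (\<Prod>i=Suc k..n. 1 - q ^ i)" for k
  have A: "A k = A (Suc k) * (1 - q ^ Suc k)" if "k < n" for k
    using that by (simp add: A_def prod.atLeast_Suc_atMost mult.commute)
  \<comment> \<open>The telescoping certificate: passing from n to n + 1 changes the k-th summand by
    g(k-1) - g(k), because A(k-1) = A(k) (1 - q^k).\<close>
  define g where "g k = (-1) ^ k * A k * q ^ (Suc k * Suc n + tri k)" for k
  define F where "F k = (-1) ^ k * A k * q ^ (k * n + tri k)" for k
  have step: "(-1) ^ k * (\<Prod>i=Suc k..Suc n. 1 - q ^ i) * q ^ (k * Suc n + tri k) - F k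
      = (if k = 0 then 0 else g (k - 1)) - g k" if "k \<le> n" for k
  proof -
    have p: "(\<Prod>i=Suc k..Suc n. 1 - q ^ i) = A k * (1 - q ^ Suc n)"
      using that by (simp add: A_def prod.nat_ivl_Suc')
    show ?thesis
    proof (cases k)
      case 0
      then show ?thesis by (simp add: p g_def F_def A_def algebra_simps)
    next
      case (Suc j)
      have Aj: "A j = A k * (1 - q ^ k)" using A[of j] that Suc by simp
      define Q where "Q = q ^ (k * Suc n + tri j)"
      have "k * Suc n + tri k = (k * Suc n + tri j) + k" "k * n + tri k = k * Suc n + tri j"
        "Suc k * Suc n + tri k = (k * Suc n + tri j) + k + Suc n"
        by (simp_all add: Suc tri_Suc)
      then have "q ^ (k * Suc n + tri k) = Q * q ^ k" "q ^ (k * n + tri k) = Q"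
        "q ^ (Suc k * Suc n + tri k) = Q * q ^ k * q ^ Suc n"
        unfolding Q_def by (simp_all only: power_add)
      moreover note Aj
      moreover have "g j = - ((-1) ^ k) * A j * Q"
        by (simp add: g_def Q_def Suc)
      moreover have "(if k = 0 then 0 else g (k - 1)) = g j" by (simp add: Suc)
      ultimately show ?thesis unfolding p F_def g_def[of k]
        by (simp only:) (simp add: algebra_simps del: power_Suc mult_Suc mult_Suc_right)
    qed
  qed
  have tel: "(\<Sum>k\<le>m. (if k = 0 then 0 else g (k - 1)) - g k) = - g m" for m
    by (induction m) simp_all
  have "(\<Sum>k\<le>n. (-1) ^ k * (\<Prod>i=Suc k..Suc n. 1 - q ^ i) * q ^ (k * Suc n + tri k)) - (\<Sum>k\<le>n. F k) =
    - g n"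
    unfolding sum_subtractf[symmetric] tel[symmetric] by (rule sum.cong[OF refl], rule step) simp
  \<comment> \<open>The boundary term left by telescoping is the first new pentagonal power; the
    second is the summand k = n + 1, which enters only now.\<close>
  moreover have "- g n = (-1) ^ Suc n * q ^ (Suc n * Suc n + tri n)"
    by (simp add: g_def A_def)
  ultimately have "(\<Sum>k\<le>n. (-1) ^ k * (\<Prod>i=Suc k..Suc n. 1 - q ^ i) * q ^ (k * Suc n + tri k))
     = (\<Sum>k\<le>n. F k) + (-1) ^ Suc n * q ^ (Suc n * Suc n + tri n)"
    by (simp add: algebra_simps)
  with Suc show ?case
    by (simp add: F_def A_def algebra_simps del: power_Suc mult_Suc mult_Suc_right)
qed simp

section \<open>Gaussian binomial coefficients and the finite form of Jacobi's identity\<close>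

fun qbin :: "'a::comm_ring_1 \<Rightarrow> nat \<Rightarrow> nat \<Rightarrow> 'a" where
  "qbin q n 0 = 1"
| "qbin q 0 (Suc k) = 0"
| "qbin q (Suc n) (Suc k) = qbin q n (Suc k) + q ^ (n - k) * qbin q n k"

lemma qbin_eq_0: "n < k \<Longrightarrow> qbin q n k = 0"
  by (induction q n k rule: qbin.induct) auto

text \<open>The quotient formula without division, hence valid in any commutative ring. The q-Pascal
  rule that defines \<open>qbin\<close> matches the split 1 - q^(a+b) = (1 - q^b) + q^b (1 -
  q^a).\<close>

lemma qbin_qfac: "qbin q (a + b) a * qfac q a * qfac q b = qfac q (a + b)"
proof (induction "a + b" arbitrary: a b)
  case (Suc n)
  show ?case
  proof (cases a)
    case a: (Suc k)
    show ?thesis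
    proof (cases b)
      case 0
      have "qbin q (k + 0) k * qfac q k * qfac q 0 = qfac q (k + 0)"
        using Suc.hyps a 0 by (intro Suc.hyps(1)) simp
      then show ?thesis by (simp add: a 0 qbin_eq_0 qfac_Suc mult.assoc[symmetric])
    next
      case b: (Suc l)
      have 1: "qbin q (a + l) a * qfac q a * qfac q l = qfac q (k + b)"
        using Suc.hyps(1)[of a l] Suc.hyps(2) a b by simp
      have 2: "qbin q (k + b) k * qfac q k * qfac q b = qfac q (k + b)"
        using Suc.hyps(1)[of k b] Suc.hyps(2) a b by simp
      have "qbin q (a + b) a * qfac q a * qfac q b =
        (qbin q (a + l) a + q ^ b * qbin q (k + b) k) * qfac q a * qfac q b"
        by (simp add: a b)
      also have "\<dots> = (qbin q (a + l) a * qfac q a * qfac q l) * (1 - q ^ b) +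
          q ^ b * (1 - q ^ a) * (qbin q (k + b) k * qfac q k * qfac q b)"
        by (simp add: a b qfac_Suc algebra_simps)
      also have "\<dots> = qfac q (k + b) * (1 - q ^ (a + b))"
        unfolding 1 2 by (simp add: algebra_simps power_add)
      also have "\<dots> = qfac q (a + b)" by (simp add: a qfac_Suc)
      finally show ?thesis .
    qed
  qed simp
qed simp

text \<open>The q-binomial theorem for the product of y - z q^i, read off as coefficients in z. The
  exponent \<open>tri (k - 1)\<close> is k(k-1)/2, also for k = 0, where the subtraction
  truncates.\<close>

lemma coeff_q_binomial:
  fixes q y :: "'a::comm_ring_1"
  shows "coeff (\<Prod>i<n. [:y, - (q ^ i):]) k = (-1) ^ k * q ^ tri (k - 1) * qbin q n k * y ^ (n - k)"
proof (induction n arbitrary: k)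
  case 0
  show ?case by (cases k) simp_all
next
  case (Suc n)
  show ?case
  proof (cases k)
    case 0
    then show ?thesis using Suc[of 0] by (simp add: mult.commute)
  next
    case k: (Suc j)
    define P where "P = (\<Prod>i<n. [:y, - (q ^ i):])"
    have "coeff (\<Prod>i<Suc n. [:y, - (q ^ i):]) k = y * coeff P k - q ^ n * coeff P j"
      by (simp add: P_def[symmetric] k mult.commute[of P])
    also have "y * coeff P k = (-1) ^ k * q ^ tri j * qbin q n k * y ^ (n - j)"
    proof (cases "j < n")
      case True
      then have "y ^ (n - j) = y * y ^ (n - k)" by (simp add: k Suc_diff_Suc flip: power_Suc)
      then show ?thesis by (simp add: P_def Suc k)
    qed (simp add: P_def Suc k qbin_eq_0)
    also have "q ^ n * coeff P j = (-1) ^ j * q ^ tri j * (q ^ (n - j) * qbin q n j) * y ^ (n - j)"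
    proof (cases "j \<le> n")
      case True
      have "tri (j - 1) + n = tri j + (n - j)"
        using True by (cases j) (simp_all add: tri_Suc)
      then have "q ^ tri (j - 1) * q ^ n = q ^ tri j * q ^ (n - j)" by (simp flip: power_add)
      moreover have "q ^ n * coeff P j =
        (-1) ^ j * (q ^ tri (j - 1) * q ^ n) * qbin q n j * y ^ (n - j)"
        by (simp add: P_def Suc ac_simps)
      ultimately show ?thesis by (simp add: ac_simps)
    qed (simp add: P_def Suc qbin_eq_0)
    finally show ?thesis by (simp add: k algebra_simps)
  qed
qed

lemma poly_pderiv_one:
  fixes P :: "'a::idom poly"
  assumes "degree P \<le> m"
  shows "poly (pderiv P) 1 = (\<Sum>k\<le>m. of_nat k * coeff P k)"
proof -
  define c where "c = coeff P"
  have "P = (\<Sum>k\<le>m. monom (c k) k)"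
    using poly_as_sum_of_monoms'[OF assms] by (simp add: c_def)
  then have "pderiv P = (\<Sum>k\<le>m. pderiv (monom (c k) k))"
    using higher_pderiv_sum[of 1 "\<lambda>k. monom (c k) k" "{..m}"] by simp
  then show ?thesis by (simp add: pderiv_monom poly_sum poly_monom c_def)
qed

lemma tri_add: "tri (n + m) = tri n + tri m + n * m"
  by (induction m) (simp_all add: tri_Suc)

text \<open>The derivative at \<open>z = 1\<close> of the finite triple product
  \<open>(\<Prod>i\<le>2n. q^n - z q^i)\<close>, whose factor with \<open>i = n\<close> vanishes there.\<close>

lemma prod_q_diff_low:
  "(\<Prod>i<n. q ^ n - q ^ i) = (-1) ^ n * q ^ tri (n - 1) * qfac (q :: 'a::comm_ring_1) n"
proof -
  have "(\<Prod>i<n. q ^ n - q ^ i) = (\<Prod>i<n. (-1) * q ^ i * (1 - q ^ Suc (n - Suc i)))"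
  proof (intro prod.cong refl)
    fix i assume "i \<in> {..<n}"
    then have "q ^ n = q ^ i * q ^ Suc (n - Suc i)" by (simp flip: power_add power_Suc)
    then show "q ^ n - q ^ i = (-1) * q ^ i * (1 - q ^ Suc (n - Suc i))"
      by (simp add: algebra_simps)
  qed
  also have "\<dots> = (-1) ^ n * (\<Prod>i<n. q ^ i) * (\<Prod>i<n. 1 - q ^ Suc (n - Suc i))"
    unfolding prod.distrib by simp
  also have "(\<Prod>i<n. 1 - q ^ Suc (n - Suc i)) = (\<Prod>i<n. 1 - q ^ Suc i)"
    by (rule prod.nat_diff_reindex)
  also have "\<dots> = qfac q n" by (induction n) (simp_all add: qfac_Suc)
  also have "(\<Prod>i<n. q ^ i) = q ^ tri (n - 1)"
  proof (induction n)
    case (Suc n)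
    then show ?case by (cases n) (simp_all add: tri_Suc power_add mult_ac)
  qed simp
  finally show ?thesis .
qed

lemma prod_q_diff_high:
  "(\<Prod>i\<in>{Suc n..<Suc n + k}. q ^ n - q ^ i) = q ^ (n * k) * qfac (q :: 'a::comm_ring_1) k"
  by (induction k) (simp_all add: qfac_Suc algebra_simps power_add)

text \<open>The pairs n - j, n + 1 + j are those that the symmetry of the Gaussian binomials
  identifies in \<open>jacobi_finite\<close>.\<close>

lemma sum_fold_middle:
  fixes h :: "nat \<Rightarrow> 'a::comm_monoid_add"
  shows "(\<Sum>k\<le>2*n+1. h k) = (\<Sum>j\<le>n. h (n - j) + h (n + 1 + j))"
proof -
  have "(\<Sum>k\<le>2*n+1. h k) = (\<Sum>k\<le>n. h k) + (\<Sum>k\<in>{n+1..2*n+1}. h k)"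
  proof -
    have "{..2*n+1} = {..n} \<union> {n+1..2*n+1}" by auto
    moreover have "sum h ({..n} \<union> {n+1..2*n+1}) = sum h {..n} + sum h {n+1..2*n+1}"
      by (rule sum.union_disjoint) auto
    ultimately show ?thesis by (simp only:)
  qed
  also have "(\<Sum>k\<le>n. h k) = (\<Sum>j\<le>n. h (n - j))"
    by (rule sum.reindex_bij_witness[of _ "\<lambda>j. n - j" "\<lambda>j. n - j"]) auto
  also have "(\<Sum>k\<in>{n+1..2*n+1}. h k) = (\<Sum>j\<le>n. h (n + 1 + j))"
    by (rule sum.reindex_bij_witness[of _ "\<lambda>j. n + 1 + j" "\<lambda>k. k - (n + 1)"]) auto
  finally show ?thesis by (simp add: sum.distrib)
qed

text \<open>The derivative of the finite triple product is computed twice: by the q-binomial theorem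
  and by the product rule. The hypotheses on q allow powers of q and values of \<open>qfac\<close>
  to be cancelled.\<close>

lemma jacobi_finite:
  fixes q :: "'a::idom"
  assumes "q \<noteq> 0" and root: "\<And>i. i > 0 \<Longrightarrow> q ^ i \<noteq> 1"
  shows "(\<Sum>k\<le>n. (-1) ^ k * of_nat (2 * k + 1) * q ^ tri k * qbin q (2 * n + 1) (n - k)) =
    qfac q n ^ 2"
proof -
  define m where "m = 2 * n + 1"
  define P where "P = (\<Prod>i<m. [:q ^ n, - (q ^ i):])"
  define R where "R = (\<Prod>i<n. [:q ^ n, - (q ^ i):]) * (\<Prod>i\<in>{Suc n..<Suc n + n}. [:q ^ n, - (q ^ i):])"
  have "degree P \<le> (\<Sum>i<m. degree [:q ^ n, - (q ^ i):])"
    unfolding P_def by (rule degree_prod_sum_le[unfolded comp_def]) simp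
  also have "\<dots> \<le> (\<Sum>i<m. 1)" by (intro sum_mono) simp
  finally have "degree P \<le> m" by simp
  then have "poly (pderiv P) 1 = (\<Sum>k\<le>m. of_nat k * coeff P k)" by (rule poly_pderiv_one)
  also have "\<dots> = (\<Sum>j\<le>n. of_nat (n - j) * coeff P (n - j) +
    of_nat (n + 1 + j) * coeff P (n + 1 + j))"
    unfolding m_def by (rule sum_fold_middle)
  also have "\<dots> = (\<Sum>j\<le>n. - ((-1) ^ n) * q ^ (tri n + n * n) *
      ((-1) ^ j * of_nat (2 * j + 1) * q ^ tri j * qbin q m (n - j)))"
  proof (intro sum.cong refl)
    fix j assume "j \<in> {..n}"
    then obtain d where d: "n = j + d" by (auto simp: le_iff_add)
    have fac: "qfac q i \<noteq> 0" for i using root by (auto simp: qfac_def)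
    have m1: "m = d + (n + 1 + j)" and m2: "m = (n + 1 + j) + d" by (simp_all add: m_def d)
    have "qbin q m d * qfac q d * qfac q (n + 1 + j) = qfac q m"
      unfolding m1 by (rule qbin_qfac)
    moreover have "qbin q m (n + 1 + j) * qfac q (n + 1 + j) * qfac q d = qfac q m"
      unfolding m2 by (rule qbin_qfac)
    ultimately have "qbin q m (n + 1 + j) * (qfac q (n + 1 + j) * qfac q d) =
      qbin q m d * (qfac q (n + 1 + j) * qfac q d)"
      by (simp only: mult.assoc mult.commute[of "qfac q d"])
    then have sym: "qbin q m (n + 1 + j) = qbin q m d" using fac by simp
    \<comment> \<open>The two partners share the Gaussian binomial by symmetry, and also the power
      of q, but have opposite signs; so the weights n - j and n + 1 + j combine to 2j + 1 up to
      sign.\<close>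
    have e1: "tri (d - 1) + n * (m - d) = tri n + n * n + tri j"
    proof -
      have "tri (d - 1) + d = tri d" by (cases d) (simp_all add: tri_Suc)
      moreover have "n * (m - d) = n * n + n * j + n"
        unfolding m_def d by (simp add: algebra_simps)
      moreover have "tri n = tri j + tri d + j * d" unfolding d by (rule tri_add)
      moreover have "2 * tri j = j * (j + 1)" by (rule two_tri)
      ultimately show ?thesis by (simp add: d algebra_simps)
    qed
    have e2: "tri (n + 1 + j - 1) + n * (m - (n + 1 + j)) = tri n + n * n + tri j"
      by (simp add: tri_add m_def d algebra_simps)
    have "q ^ (tri n + n * n + tri j) = q ^ tri (d - 1) * (q ^ n) ^ (m - d)"
      by (simp only: e1[symmetric] power_add power_mult)
    then have c1: "coeff P d = (-1) ^ d * qbin q m d * q ^ (tri n + n * n + tri j)"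
      unfolding P_def coeff_q_binomial by (simp only: mult_ac)
    have "q ^ (tri n + n * n + tri j) = q ^ tri (n + 1 + j - 1) * (q ^ n) ^ (m - (n + 1 + j))"
      by (simp only: e2[symmetric] power_add power_mult)
    then have c2: "coeff P (n + 1 + j) =
      (-1) ^ (n + 1 + j) * qbin q m d * q ^ (tri n + n * n + tri j)"
      unfolding P_def coeff_q_binomial sym by (simp only: mult_ac)
    have "(-1 :: 'a) ^ n * (-1) ^ j = (-1) ^ (d + 2 * j)"
      unfolding power_add[symmetric] by (rule arg_cong[where f = "power (-1)"]) (simp add: d)
    then have s: "(-1 :: 'a) ^ d = (-1) ^ n * (-1) ^ j" by (simp add: power_add)
    have "of_nat d * coeff P d + of_nat (n + 1 + j) * coeff P (n + 1 + j) =
       - ((-1) ^ n) * q ^ (tri n + n * n) * ((-1) ^ j * of_nat (2 * j + 1) * q ^ tri j * qbin q m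
         d)"
      unfolding c1 c2 s power_add[of q] power_add[of "-1"] by (simp add: d algebra_simps)
    then show "of_nat (n - j) * coeff P (n - j) + of_nat (n + 1 + j) * coeff P (n + 1 + j) =
       - ((-1) ^ n) * q ^ (tri n + n * n) * ((-1) ^ j * of_nat (2 * j + 1) * q ^ tri j * qbin q
         m (n - j))"
      by (simp add: d)
  qed
  also have "\<dots> = - ((-1) ^ n) * q ^ (tri n + n * n) *
      (\<Sum>j\<le>n. (-1) ^ j * of_nat (2 * j + 1) * q ^ tri j * qbin q m (n - j))"
    by (rule sum_distrib_left[symmetric])
  finally have 1: "poly (pderiv P) 1 = \<dots>" .
  define L where "L i = [:q ^ n, - (q ^ i):]" for i
  have "{..<m} = {..<n} \<union> insert n {Suc n..<Suc n + n}" by (auto simp: m_def)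
  moreover have "prod L ({..<n} \<union> insert n {Suc n..<Suc n + n}) =
    prod L {..<n} * prod L (insert n {Suc n..<Suc n + n})"
    by (rule prod.union_disjoint) auto
  moreover have "prod L (insert n {Suc n..<Suc n + n}) = L n * prod L {Suc n..<Suc n + n}"
    by (rule prod.insert) auto
  ultimately have "P = L n * R"
    unfolding P_def R_def L_def[symmetric] by (simp only: mult_ac)
  then have "P = [:q ^ n, - (q ^ n):] * R" unfolding L_def .
  \<comment> \<open>The factor with i = n vanishes at 1, so only the term in which it is
    differentiated survives.\<close>
  then have "poly (pderiv P) 1 = - (q ^ n) * poly R 1"
    by (simp only: pderiv_mult) (simp add: pderiv_pCons)
  also have "poly R 1 = (\<Prod>i<n. q ^ n - q ^ i) * (\<Prod>i\<in>{Suc n..<Suc n + n}. q ^ n - q ^ i)"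
  proof -
    have "poly (L i) 1 = q ^ n - q ^ i" for i by (simp add: L_def)
    then show ?thesis by (simp only: R_def L_def[symmetric] poly_mult poly_prod)
  qed
  also have "\<dots> = (-1) ^ n * q ^ (tri (n - 1) + n * n) * qfac q n ^ 2"
    unfolding prod_q_diff_low prod_q_diff_high by (simp add: power_add power2_eq_square)
  also have "- (q ^ n) * \<dots> = - ((-1) ^ n) * q ^ (tri n + n * n) * qfac q n ^ 2"
  proof -
    have "n + (tri (n - 1) + n * n) = tri n + n * n" by (cases n) (simp_all add: tri_Suc)
    then have "q ^ n * q ^ (tri (n - 1) + n * n) = q ^ (tri n + n * n)"
      by (simp only: power_add[symmetric])
    then show ?thesis by (simp add: mult_ac)
  qed
  finally show ?thesis using 1 \<open>q \<noteq> 0\<close> by (simp add: m_def)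
qed

text \<open>The nontrivial character modulo 4: it is (-1)^k at x = 2k + 1, the sign in Jacobi's
  series.\<close>

definition chi4 :: "nat \<Rightarrow> int" where
  "chi4 x = (if x mod 4 = 1 then 1 else if x mod 4 = 3 then -1 else 0)"

text \<open>The Kronecker symbol (12/x): it gives the signs in Euler's series once exponents are
  written as x^2 = 24N + 1.\<close>

definition chi12 :: "nat \<Rightarrow> int" where
  "chi12 x = (if x mod 12 \<in> {1, 11} then 1 else if x mod 12 \<in> {5, 7} then -1 else 0)"

section \<open>The coefficients of the Euler function and of its cube\<close>

definition fps_eq_below :: "nat \<Rightarrow> 'a::comm_ring_1 fps \<Rightarrow> 'a fps \<Rightarrow> bool" where
  "fps_eq_below d F G \<longleftrightarrow> (\<forall>i<d. F $ i = G $ i)"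

lemma fps_eq_below_refl [simp]: "fps_eq_below d F F"
  by (simp add: fps_eq_below_def)

lemma fps_eq_below_sym: "fps_eq_below d F G \<Longrightarrow> fps_eq_below d G F"
  by (simp add: fps_eq_below_def)

lemma fps_eq_below_trans [trans]:
  "fps_eq_below d F G \<Longrightarrow> fps_eq_below d G H \<Longrightarrow> fps_eq_below d F H"
  by (simp add: fps_eq_below_def)

lemma fps_eq_below_mono: "fps_eq_below d F G \<Longrightarrow> e \<le> d \<Longrightarrow> fps_eq_below e F G"
  by (simp add: fps_eq_below_def)

lemma fps_eq_below_mult:
  "fps_eq_below d F G \<Longrightarrow> fps_eq_below d F' G' \<Longrightarrow> fps_eq_below d (F * F') (G * G')"
  by (auto simp: fps_eq_below_def fps_mult_nth intro!: sum.cong)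

lemma fps_eq_below_power: "fps_eq_below d F G \<Longrightarrow> fps_eq_below d (F ^ m) (G ^ m)"
  by (induction m) (simp_all add: fps_eq_below_mult)

lemma fps_eq_below_sum:
  "(\<And>i. i \<in> A \<Longrightarrow> fps_eq_below d (F i) (G i)) \<Longrightarrow> fps_eq_below d (sum F A) (sum G A)"
  by (simp add: fps_eq_below_def fps_sum_nth)

lemma fps_eq_below_X_mult:
  "fps_eq_below d F G \<Longrightarrow> fps_eq_below (a + d) (fps_X ^ a * F) (fps_X ^ a * G)"
  by (auto simp: fps_eq_below_def fps_X_power_mult_nth)

text \<open>Each factor of index i \<ge> n is 1 modulo X^(n+1), so the partial products are
  stationary from n on and agree with their limit.\<close>

lemma p_gen_eq_below:
  "fps_eq_below (Suc n) (p_gen t) (\<Prod>i<n. euler_factor_powr t (Suc i))"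
proof -
  define f where "f i = euler_factor_powr t (Suc i)" for i
  have "f i $ 0 \<noteq> 0" for i by (simp add: f_def euler_factor_powr_nth_small)
  \<comment> \<open>Rules out the second case of \<open>has_prod\<close>, a product that is 0
    because of a vanishing factor.\<close>
  then have nz: "f i \<noteq> 0" for i by (metis fps_zero_nth)
  have "f has_prod p_gen t" unfolding f_def by (rule has_prod_p_gen)
  then have "(\<lambda>n. \<Prod>i\<le>n. f i) \<longlonglongrightarrow> p_gen t"
    using nz by (auto simp: has_prod_def raw_has_prod_def)
  then have ev: "\<forall>\<^sub>F n in sequentially. (\<Prod>i\<le>n. f i) $ m = p_gen t $ m" for m
    by (simp add: tendsto_fps_iff)
  have one: "fps_eq_below (Suc n) (f i) 1" if "i \<ge> n" for i
    using that by (simp add: fps_eq_below_def f_def euler_factor_powr_nth_small)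
  have stab: "fps_eq_below (Suc n) (prod f {..<n + k}) (prod f {..<n})" for k
  proof (induction k)
    case (Suc k)
    show ?case using fps_eq_below_mult[OF Suc one[of "n + k"]] by simp
  qed simp
  show ?thesis unfolding fps_eq_below_def
  proof (intro allI impI)
    fix m assume "m < Suc n"
    obtain K where "\<And>k. k \<ge> K \<Longrightarrow> (\<Prod>i\<le>k. f i) $ m = p_gen t $ m"
      using ev[of m] by (auto simp: eventually_sequentially)
    from this[of "n + K"] have "prod f {..<n + Suc K} $ m = p_gen t $ m"
      by (simp add: lessThan_Suc_atMost)
    with stab[of "Suc K"] \<open>m < Suc n\<close>
    show "p_gen t $ m = (\<Prod>i<n. euler_factor_powr t (Suc i)) $ m"
      by (simp add: fps_eq_below_def f_def)
  qed
qed

lemma fps_eq_below_all: "(\<And>n. fps_eq_below (Suc n) F G) \<Longrightarrow> F = G"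
  by (auto simp: fps_eq_below_def intro!: fps_ext)

lemma p_gen_add: "p_gen (s + t) = p_gen s * p_gen t"
proof (rule fps_eq_below_all)
  fix n
  have "euler_factor_powr (s + t) (Suc i) =
    euler_factor_powr s (Suc i) * euler_factor_powr t (Suc i)" for i
    unfolding euler_factor_powr_def
    by (simp add: fps_binomial_add_mult fps_compose_mult_distrib)
  then have "(\<Prod>i<n. euler_factor_powr (s + t) (Suc i)) =
     (\<Prod>i<n. euler_factor_powr s (Suc i)) * (\<Prod>i<n. euler_factor_powr t (Suc i))"
    by (simp add: prod.distrib)
  then show "fps_eq_below (Suc n) (p_gen (s + t)) (p_gen s * p_gen t)"
    by (metis p_gen_eq_below fps_eq_below_mult fps_eq_below_sym fps_eq_below_trans)
qed

lemma p_gen_0: "p_gen 0 = 1"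
  using p_gen_eq_below[of _ 0]
  by (intro fps_eq_below_all) (simp add: euler_factor_powr_def)

lemma p_gen_of_nat_mult: "p_gen (of_nat m * t) = p_gen t ^ m"
  by (induction m) (simp_all add: p_gen_0 p_gen_add distrib_right)

abbreviation euler_fn :: "rat fps" where "euler_fn \<equiv> p_gen 1"

lemma euler_fn_eq_below: "n \<le> m \<Longrightarrow> fps_eq_below (Suc n) euler_fn (qfac fps_X m)"
proof -
  assume "n \<le> m"
  have "(\<Prod>i<m. euler_factor_powr 1 (Suc i)) = qfac fps_X m"
    by (induction m) (simp_all add: qfac_Suc euler_factor_powr_def fps_binomial_1
      fps_compose_add_distrib)
  then show ?thesis using p_gen_eq_below[of m 1] \<open>n \<le> m\<close>
    by (auto intro: fps_eq_below_mono)
qed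

lemma euler_fn_mult_inverse: "euler_fn * p_gen (-1) = 1"
  using p_gen_add[of 1 "-1"] by (simp add: p_gen_0)

section \<open>Euler's pentagonal number theorem in terms of squares\<close>

lemma chi12_cases:
  fixes x N :: nat
  assumes "x * x = 24 * N + 1"
  shows "x = 1 \<or> (\<exists>k. x = 6 * k + 5) \<or> (\<exists>k. x = 6 * k + 7)"
proof -
  define a r where "a = x div 6" and "r = x mod 6"
  have x: "x = 6 * a + r" by (simp add: a_def r_def)
  have "(x * x) mod 6 = 1" using assms by presburger
  then have "(r * r) mod 6 = 1" by (simp add: r_def mod_simps)
  moreover have "r < 6" by (simp add: r_def)
  then have "r \<in> {0,1,2,3,4,5}" by auto
  ultimately have "r = 1 \<or> r = 5" by auto
  then show ?thesis
  proof
    assume "r = 1"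
    then show ?thesis using x by (cases a) auto
  qed (use x in auto)
qed

lemma minus_one_power_eq_fps_const: "(-1 :: 'a::comm_ring_1 fps) ^ k = fps_const ((-1) ^ k)"
  by (induction k) simp_all

text \<open>In \<open>pentagonal_finite\<close> with n = N only the summand k = 0 on the left
  reaches degree N. Completing the square turns the two families of exponents into (6k+5)^2 and
  (6k+7)^2.\<close>

lemma euler_fn_nth:
  "euler_fn $ N = (if N = 0 then 1 else 0) + (\<Sum>k<N.
     (if (6 * k + 5) * (6 * k + 5) = 24 * N + 1 then of_int (chi12 (6 * k + 5)) else 0) +
     (if (6 * k + 7) * (6 * k + 7) = 24 * N + 1 then of_int (chi12 (6 * k + 7)) else 0))"
proof -
  define T :: "nat \<Rightarrow> rat fps" where "T k =
    (-1) ^ k * (\<Prod>i=Suc k..N. 1 - fps_X ^ i) * fps_X ^ (k * N + tri k)" for k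
  have "T k $ N = (if k = 0 then qfac fps_X N $ N else (0::rat))" for k
  proof (cases k)
    case (Suc j)
    then have "N < k * N + tri k" using tri_ge[of k] by simp
    then show ?thesis using Suc by (simp add: T_def fps_X_power_mult_right_nth)
  qed (simp add: T_def qfac_def)
  then have "(\<Sum>k\<le>N. T k) $ N = (qfac fps_X N $ N :: rat)" by (simp add: fps_sum_nth)
  also have "\<dots> = euler_fn $ N"
    using euler_fn_eq_below[of N N] by (simp add: fps_eq_below_def)
  finally have "euler_fn $ N = (1 + (\<Sum>k<N. (-1) ^ Suc k *
    (fps_X ^ (Suc k * Suc k + tri k) + fps_X ^ (Suc k * Suc k + tri (Suc k))))) $ N"
    unfolding T_def pentagonal_finite by simp
  also have "\<dots> = (if N = 0 then 1 else 0) + (\<Sum>k<N.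
     (if (6 * k + 5) * (6 * k + 5) = 24 * N + 1 then of_int (chi12 (6 * k + 5)) else 0) +
     (if (6 * k + 7) * (6 * k + 7) = 24 * N + 1 then of_int (chi12 (6 * k + 7)) else 0))"
    unfolding fps_add_nth fps_sum_nth
  proof (intro arg_cong2[where f = plus] sum.cong refl)
    fix k
    have "of_int (chi12 (6 * k + 5)) = (-1 :: rat) ^ Suc k \<and> of_int (chi12 (6 * k + 7)) =
      (-1 :: rat) ^ Suc k"
    proof (cases "even k")
      case True
      then obtain m where k: "k = 2 * m" by (elim evenE)
      have "6 * k + 5 = 5 + 12 * m" "6 * k + 7 = 7 + 12 * m" by (simp_all add: k)
      then show ?thesis unfolding chi12_def by (simp only: mod_mult_self2) (simp add: k)
    next
      case False
      then obtain m where k: "k = 2 * m + 1" by (elim oddE)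
      have "6 * k + 5 = 11 + 12 * m" "6 * k + 7 = 1 + 12 * (m + 1)" by (simp_all add: k)
      then show ?thesis unfolding chi12_def by (simp only: mod_mult_self2) (simp add: k)
    qed
    then have sgn: "of_int (chi12 (6 * k + 5)) = (-1 :: rat) ^ Suc k"
      "of_int (chi12 (6 * k + 7)) = (-1 :: rat) ^ Suc k"
      by simp_all
    have a: "24 * (Suc k * Suc k + tri k) + 1 = (6 * k + 5) * (6 * k + 5)"
      "24 * (Suc k * Suc k + tri (Suc k)) + 1 = (6 * k + 7) * (6 * k + 7)"
      using two_tri[of k] by (simp_all add: tri_Suc algebra_simps)
    have e: "(6 * k + 5) * (6 * k + 5) = 24 * N + 1 \<longleftrightarrow> N = Suc k * Suc k + tri k"
      "(6 * k + 7) * (6 * k + 7) = 24 * N + 1 \<longleftrightarrow> N = Suc k * Suc k + tri (Suc k)"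
      unfolding a[symmetric] by auto
    show "((-1) ^ Suc k * (fps_X ^ (Suc k * Suc k + tri k) +
      fps_X ^ (Suc k * Suc k + tri (Suc k)))) $ N
       = (if (6 * k + 5) * (6 * k + 5) = 24 * N + 1 then of_int (chi12 (6 * k + 5)) else (0::rat)) +
     (if (6 * k + 7) * (6 * k + 7) = 24 * N + 1 then of_int (chi12 (6 * k + 7)) else 0)"
      unfolding sgn e minus_one_power_eq_fps_const fps_mult_left_const_nth fps_add_nth
        fps_X_power_nth by simp
  qed simp
  finally show ?thesis .
qed

lemma euler_fn_nth_square:
  assumes "x * x = 24 * N + 1"
  shows "euler_fn $ N = of_int (chi12 x)"
proof -
  have iff: "y * y = 24 * N + 1 \<longleftrightarrow> y = x" for y
    using assms by (metis less_irrefl mult_strict_mono' nat_neq_iff zero_le)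
  have "euler_fn $ N = (if N = 0 then 1 else 0) +
    (\<Sum>k<N. if x = 6 * k + 5 then of_int (chi12 x) else 0)
     + (\<Sum>k<N. if x = 6 * k + 7 then of_int (chi12 x) else 0)"
    unfolding euler_fn_nth iff by (simp add: sum.distrib eq_commute[of _ x] cong: if_cong)
  then show ?thesis using chi12_cases[OF assms]
  proof (elim disjE exE)
    assume "x = 1"
    then show ?thesis using assms \<open>euler_fn $ N = _\<close> by (simp add: chi12_def)
  next
    fix k assume k: "x = 6 * k + 5"
    \<comment> \<open>The root has to be matched by an index k < N, the range of the sum.\<close>
    have "24 * N = 36 * (k * k) + 60 * k + 24" using assms k by (simp add: algebra_simps)
    then have "k < N" using zero_le[of "k*k"] by linarith
    moreover have "6 * k + 5 \<noteq> 6 * l + 7" for l by presburger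
    ultimately show ?thesis using \<open>euler_fn $ N = _\<close> by (simp add: k)
  next
    fix k assume k: "x = 6 * k + 7"
    have "24 * N = 36 * (k * k) + 84 * k + 48" using assms k by (simp add: algebra_simps)
    then have "k < N" using zero_le[of "k*k"] by linarith
    moreover have "6 * k + 7 \<noteq> 6 * l + 5" for l by presburger
    ultimately show ?thesis using \<open>euler_fn $ N = _\<close> by (simp add: k)
  qed
qed

lemma euler_fn_nth_nonsquare:
  assumes "\<And>x. x * x \<noteq> 24 * N + 1"
  shows "euler_fn $ N = 0"
  using assms[of 1] assms unfolding euler_fn_nth by simp

text \<open>The left side is a quotient of two values of \<open>qfac\<close> by two others, and all
  four agree with the Euler function to this order. Division by it is multiplication by
  \<open>p_gen (-1)\<close>.\<close>

lemma qbin_qfac_eq_below: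
  assumes "k \<le> n"
  shows "fps_eq_below (Suc (n - k)) (qbin fps_X (2 * n + 1) (n - k) * qfac fps_X n) (1 :: rat fps)"
proof -
  define E :: "rat fps" where "E = qbin fps_X (2 * n + 1) (n - k) * qfac fps_X n"
  let ?eq = "fps_eq_below (Suc (n - k))"
  have q: "?eq euler_fn (qfac fps_X m)" if "n - k \<le> m" for m
    using that by (rule euler_fn_eq_below)
  have e: "2 * n + 1 = (n - k) + (n + 1 + k)" using assms by simp
  have "qbin fps_X (2 * n + 1) (n - k) * qfac fps_X (n - k) * qfac fps_X (n + 1 + k) =
    (qfac fps_X (2 * n + 1) :: rat fps)"
    unfolding e by (rule qbin_qfac)
  moreover have "qfac fps_X (n - k) * qfac fps_X (n + 1 + k) * E =
      (qbin fps_X (2 * n + 1) (n - k) * qfac fps_X (n - k) * qfac fps_X (n + 1 + k)) * qfac fps_X n"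
    unfolding E_def by (simp only: mult_ac)
  ultimately have id: "qfac fps_X (n - k) * qfac fps_X (n + 1 + k) * E =
    qfac fps_X (2 * n + 1) * qfac fps_X n"
    by (simp only:)
  have "?eq (euler_fn * euler_fn * E) (qfac fps_X (n - k) * qfac fps_X (n + 1 + k) * E)"
    by (intro fps_eq_below_mult q) simp_all
  also have "?eq (qfac fps_X (n - k) * qfac fps_X (n + 1 + k) * E) (euler_fn * euler_fn)"
    unfolding id by (intro fps_eq_below_sym[OF fps_eq_below_mult] q) simp_all
  finally have "?eq (p_gen (-1) * p_gen (-1) * (euler_fn * euler_fn * E))
    (p_gen (-1) * p_gen (-1) * (euler_fn * euler_fn))"
    by (rule fps_eq_below_mult[OF fps_eq_below_refl])
  moreover have "p_gen (-1) * p_gen (-1) * (euler_fn * euler_fn) =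
    (euler_fn * p_gen (-1)) * (euler_fn * p_gen (-1))"
    by (simp add: mult_ac)
  then have "p_gen (-1) * p_gen (-1) * (euler_fn * euler_fn) = 1"
    by (simp add: euler_fn_mult_inverse)
  ultimately show ?thesis by (simp add: E_def mult.assoc[symmetric])
qed

text \<open>Multiplying \<open>jacobi_finite\<close> by one more \<open>qfac\<close> turns each
  Gaussian binomial into 1 modulo X^(N-k+1). The shift by \<open>tri k\<close>, which is at least k,
  makes up for the lost precision, and 8 \<open>tri k\<close> + 1 = (2k+1)^2.\<close>

lemma euler_fn_cube_nth:
  "(euler_fn ^ 3) $ N = (\<Sum>k\<le>N. if (2 * k + 1) * (2 * k + 1) =
    8 * N + 1 then of_int (chi4 (2 * k + 1)) * of_nat (2 * k + 1) else 0)"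
proof -
  define c where "c k = (-1 :: rat fps) ^ k * of_nat (2 * k + 1)" for k
  let ?eq = "fps_eq_below (Suc N)"
  have rt: "(fps_X :: rat fps) ^ i \<noteq> 1" if "i > 0" for i
  proof -
    have "((fps_X :: rat fps) ^ i) $ 0 \<noteq> 1 $ 0" using that by (simp add: fps_X_power_nth)
    then show ?thesis by metis
  qed
  have "?eq (euler_fn ^ 3) (qfac fps_X N ^ 3)"
    by (intro fps_eq_below_power euler_fn_eq_below) simp
  also have "qfac fps_X N ^ 3 = (\<Sum>k\<le>N. c k *
    (fps_X ^ tri k * (qbin fps_X (2 * N + 1) (N - k) * qfac fps_X N)))"
  proof -
    have "qfac fps_X N ^ 3 = qfac fps_X N ^ 2 * (qfac fps_X N :: rat fps)"
      by (simp add: power2_eq_square power3_eq_cube)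
    also have "\<dots> = (\<Sum>k\<le>N. c k * fps_X ^ tri k * qbin fps_X (2 * N + 1) (N - k)) * qfac fps_X N"
      using jacobi_finite[of "fps_X :: rat fps" N] rt by (simp add: c_def)
    also have "\<dots> = (\<Sum>k\<le>N. c k * (fps_X ^ tri k * (qbin fps_X (2 * N + 1) (N - k) * qfac fps_X N)))"
      by (simp add: sum_distrib_right mult.assoc)
    finally show ?thesis .
  qed
  also have "?eq \<dots> (\<Sum>k\<le>N. c k * (fps_X ^ tri k * 1))"
  proof (rule fps_eq_below_sum, rule fps_eq_below_mult[OF fps_eq_below_refl])
    fix k assume "k \<in> {..N}"
    then have "fps_eq_below (tri k + Suc (N - k))
      (fps_X ^ tri k * (qbin fps_X (2 * N + 1) (N - k) * qfac fps_X N)) (fps_X ^ tri k * (1 :: rat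
        fps))"
      by (intro fps_eq_below_X_mult qbin_qfac_eq_below) simp
    moreover have "Suc N \<le> tri k + Suc (N - k)" using tri_ge[of k] by linarith
    ultimately show "?eq (fps_X ^ tri k * (qbin fps_X (2 * N + 1) (N - k) * qfac fps_X N))
      (fps_X ^ tri k * (1 :: rat fps))"
      by (rule fps_eq_below_mono)
  qed
  finally have "(euler_fn ^ 3) $ N = (\<Sum>k\<le>N. c k * fps_X ^ tri k) $ N"
    by (simp add: fps_eq_below_def)
  also have "\<dots> = (\<Sum>k\<le>N. if (2 * k + 1) * (2 * k + 1) =
    8 * N + 1 then of_int (chi4 (2 * k + 1)) * of_nat (2 * k + 1) else 0)"
    unfolding fps_sum_nth
  proof (intro sum.cong refl)
    fix k
    have a: "8 * tri k + 1 = (2 * k + 1) * (2 * k + 1)"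
      using two_tri[of k] by (simp add: algebra_simps)
    have e: "(2 * k + 1) * (2 * k + 1) = 8 * N + 1 \<longleftrightarrow> N = tri k"
      unfolding a[symmetric] by auto
    have "k mod 2 = 0 \<Longrightarrow> (2 * k + 1) mod 4 = 1" "k mod 2 = 1 \<Longrightarrow> (2 * k + 1) mod 4 = 3" by presburger+
    then have s: "of_int (chi4 (2 * k + 1)) = (-1 :: rat) ^ k"
      by (cases "even k") (simp_all add: chi4_def even_iff_mod_2_eq_zero odd_iff_mod_2_eq_one)
    have c: "c k = fps_const ((-1) ^ k * of_nat (2 * k + 1))"
      unfolding c_def minus_one_power_eq_fps_const fps_of_nat[symmetric] by simp
    show "(c k * fps_X ^ tri k) $ N = (if (2 * k + 1) * (2 * k + 1) =
      8 * N + 1 then of_int (chi4 (2 * k + 1)) * of_nat (2 * k + 1) else 0)"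
      unfolding c fps_mult_left_const_nth fps_X_power_nth e s by simp
  qed
  finally show ?thesis .
qed

lemma euler_fn_cube_nth_square:
  assumes "x * x = 8 * N + 1"
  shows "(euler_fn ^ 3) $ N = of_int (chi4 x) * of_nat x"
proof -
  have iff: "y * y = 8 * N + 1 \<longleftrightarrow> y = x" for y
    using assms by (metis less_irrefl mult_strict_mono' nat_neq_iff zero_le)
  have "odd (x * x)" unfolding assms by simp
  then obtain k where k: "x = 2 * k + 1" by (auto elim: oddE)
  have "8 * N = 4 * (k * k) + 4 * k" using assms k by (simp add: algebra_simps)
  moreover have "k \<le> k * k" by (cases k) auto
  ultimately have "k \<le> N" by linarith
  then show ?thesis
    unfolding euler_fn_cube_nth iff by (simp add: k cong: if_cong)
qed

lemma euler_fn_cube_nth_nonsquare: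
  assumes "\<And>x. x * x \<noteq> 8 * N + 1"
  shows "(euler_fn ^ 3) $ N = 0"
  unfolding euler_fn_cube_nth by (simp only: assms if_False sum.neutral_const)

section \<open>Dissections of powers of the Euler function\<close>

text \<open>Exponents are kept in place, not divided by p, so that the sections form a grading of
  the power series by the residues modulo p.\<close>

definition fps_section :: "nat \<Rightarrow> nat \<Rightarrow> 'a::comm_ring_1 fps \<Rightarrow> 'a fps" where
  "fps_section p r F = Abs_fps (\<lambda>n. if n mod p = r then F $ n else 0)"

lemma fps_section_nth: "fps_section p r F $ n = (if n mod p = r then F $ n else 0)"
  by (simp add: fps_section_def)

text \<open>Multiplication respects the grading; \<open>(r + p - i) mod p\<close> is r - i modulo p
  without truncated subtraction.\<close>

lemma fps_section_mult:
  assumes "r < p"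
  shows "fps_section p r (F * G) = (\<Sum>i<p. fps_section p i F * fps_section p ((r + p - i) mod p) G)"
proof (rule fps_ext)
  fix n
  have split: "(n - j) mod p = (r + p - j mod p) mod p \<longleftrightarrow> n mod p = r" if "j \<le> n" for j
  proof -
    have "j mod p < p" "j = p * (j div p) + j mod p" using assms by simp_all
    then have "r + p - j mod p + j = r + p + p * (j div p)" by linarith
    then have "[r + p - j mod p + j = r] (mod p)" by (simp add: cong_def)
    moreover have "(n - j) mod p = (r + p - j mod p) mod p \<longleftrightarrow>
      [(n - j) + j = r + p - j mod p + j] (mod p)"
      unfolding cong_add_rcancel_nat by (simp add: cong_def)
    ultimately show ?thesis using that assms by (simp add: cong_def)
  qed
  have "(\<Sum>i<p. fps_section p i F * fps_section p ((r + p - i) mod p) G) $ n =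
     (\<Sum>i<p. \<Sum>j=0..n. if j mod p = i then F $ j * (if (n - j) mod p = (r + p - j mod p) mod p
       then G $ (n - j) else 0) else 0)"
    unfolding fps_sum_nth fps_mult_nth by (intro sum.cong refl) (auto simp: fps_section_nth)
  also have "\<dots> = (\<Sum>j=0..n. \<Sum>i<p. if j mod p =
    i then F $ j * (if (n - j) mod p = (r + p - j mod p) mod p then G $ (n - j) else 0) else 0)"
    by (rule sum.swap)
  also have "\<dots> = (\<Sum>j=0..n. F $ j * (if n mod p = r then G $ (n - j) else 0))"
    using assms by (intro sum.cong refl) (simp add: split)
  also have "\<dots> = fps_section p r (F * G) $ n"
    by (simp add: fps_section_nth fps_mult_nth)
  finally show "fps_section p r (F * G) $ n =
    (\<Sum>i<p. fps_section p i F * fps_section p ((r + p - i) mod p) G) $ n" ..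
qed

text \<open>If \<open>x^2 = cN + 1\<close> with \<open>N \<equiv> e (mod p)\<close>, then \<open>p\<close> divides \<open>x\<close> because
  \<open>p^2 = ce + 1\<close>; hence \<open>p^2\<close> divides \<open>c(N - e)\<close>, and \<open>N = p^2 M + e\<close>.\<close>

lemma fps_section_quadratic:
  fixes F :: "rat fps"
  assumes sq: "\<And>x N. x * x = c * N + 1 \<Longrightarrow> F $ N = h x"
    and nonsq: "\<And>N. (\<And>x. x * x \<noteq> c * N + 1) \<Longrightarrow> F $ N = 0"
    and p: "prime p" "p * p = c * e + 1" "e < p"
    and h: "\<And>y. h (p * y) = l * h y"
  shows "fps_section p e F = fps_const l * (fps_X ^ e * (F oo fps_X ^ (p ^ 2)))"
proof (rule fps_ext)
  fix N
  have cop: "coprime (p ^ 2) c"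
  proof (rule coprimeI)
    fix d assume "d dvd p ^ 2" "d dvd c"
    then have "d dvd c * e + 1" "d dvd c * e"
      unfolding p(2)[symmetric] by (simp_all add: power2_eq_square)
    then have "d dvd (c * e + 1) - c * e" using dvd_diff_nat by blast
    then show "is_unit d" by simp
  qed
  have pp: "p ^ 2 = c * e + 1" using p(2) by (simp add: power2_eq_square)
  have root: "\<exists>y. x = p * y" if "x * x = c * N + 1" "N mod p = e" for x
  proof -
    have "[c * N + 1 = c * e + 1] (mod p)"
      using that(2) p(3) by (intro cong_add cong_mult cong_refl) (simp add: cong_def)
    then have "[x * x = p * p] (mod p)" by (simp add: that p(2))
    then have "p dvd x * x" by (simp add: cong_def mod_eq_0_iff_dvd)
    then show ?thesis using p(1) by (auto simp: prime_dvd_mult_iff elim: dvdE)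
  qed
  show "fps_section p e F $ N = (fps_const l * (fps_X ^ e * (F oo fps_X ^ (p ^ 2)))) $ N"
  proof (cases "\<exists>M. N = p ^ 2 * M + e")
    case True
    then obtain M where N: "N = p ^ 2 * M + e" by blast
    have "N mod p = e" using p(3) by (simp add: N power2_eq_square mult.assoc)
    \<comment> \<open>This is where p^2 = ce + 1 enters: the roots for N are p times the roots for
      M.\<close>
    have cN: "c * N + 1 = p ^ 2 * (c * M + 1)"
      by (simp add: N pp algebra_simps)
    have "F $ N = l * F $ M"
    proof (cases "\<exists>y. y * y = c * M + 1")
      case True
      then obtain y where y: "y * y = c * M + 1" by blast
      then have "(p * y) * (p * y) = c * N + 1"
        unfolding cN y[symmetric] by (simp add: power2_eq_square mult_ac)
      from sq[OF this] sq[OF y] show ?thesis by (simp add: h)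
    next
      case False
      have "x * x \<noteq> c * N + 1" for x
      proof
        assume x: "x * x = c * N + 1"
        then obtain y where "x = p * y" using root \<open>N mod p = e\<close> by blast
        then have "p ^ 2 * (y * y) = p ^ 2 * (c * M + 1)"
          using x unfolding cN by (simp add: power2_eq_square mult_ac)
        then have "y * y = c * M + 1"
          by (subst (asm) mult_cancel1) (use p(1) in auto)
        with False show False by blast
      qed
      with False show ?thesis by (simp add: nonsq)
    qed
    moreover have "0 < p ^ 2" using p(1) by (simp add: prime_gt_0_nat)
    ultimately show ?thesis using \<open>N mod p = e\<close>
      by (simp add: fps_section_nth fps_X_power_mult_nth fps_nth_compose_X_power N)
  next
    case False
    have "fps_section p e F $ N = 0"
    proof (cases "N mod p = e")
      case True
      have "x * x \<noteq> c * N + 1" for x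
      proof
        assume x: "x * x = c * N + 1"
        then obtain y where "x = p * y" using root True by blast
        then have "p ^ 2 * y ^ 2 = c * N + 1" using x by (simp add: power2_eq_square mult_ac)
        moreover have e: "e \<le> N" using True by auto
        then have "c * N + 1 = c * (N - e) + p ^ 2" by (simp add: pp algebra_simps)
        ultimately have "p ^ 2 dvd c * (N - e) + p ^ 2" by (metis dvd_triv_left)
        then have "p ^ 2 dvd N - e" using cop by (simp add: coprime_dvd_mult_right_iff)
        then obtain M where "N - e = p ^ 2 * M" by (elim dvdE)
        then have "N = p ^ 2 * M + e" using e by simp
        with False show False by blast
      qed
      then show ?thesis by (simp add: fps_section_nth nonsq)
    qed (simp add: fps_section_nth)
    moreover have "\<not> p ^ 2 dvd N - e" if "e \<le> N"
    proof
      assume "p ^ 2 dvd N - e"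
      then obtain M where "N - e = p ^ 2 * M" by (elim dvdE)
      then have "N = p ^ 2 * M + e" using that by simp
      with False show False by blast
    qed
    ultimately show ?thesis
      by (simp add: fps_X_power_mult_nth fps_nth_compose_X_power)
  qed
qed

lemma fps_section_zeroI:
  assumes "\<And>N. N mod p = r \<Longrightarrow> F $ N = 0"
  shows "fps_section p r F = 0"
  by (rule fps_ext) (simp add: fps_section_nth assms)

section \<open>Dissections of the Euler function and its cube, and of the sixth power modulo 3 and
  7\<close>

lemma chi12_5: "chi12 (5 * y) = - chi12 y"
proof -
  have "y = 12 * (y div 12) + y mod 12" by simp
  define a r where "a = y div 12" and "r = y mod 12"
  have "(5 * y) mod 12 = (5 * r) mod 12" by (simp add: r_def mod_simps)
  moreover have "r < 12" by (simp add: r_def)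
  then have "r \<in> {0,1,2,3,4,5,6,7,8,9,10,11}" unfolding insert_iff empty_iff by presburger
  ultimately show ?thesis unfolding chi12_def r_def[symmetric] by auto
qed

lemma chi4_mult:
  assumes "p mod 4 = 1 \<or> p mod 4 = 3"
  shows "chi4 (p * y) = chi4 p * chi4 y"
proof -
  define r where "r = y mod 4"
  have "(p * y) mod 4 = ((p mod 4) * r) mod 4" by (simp add: r_def mod_simps)
  moreover have "r < 4" by (simp add: r_def)
  then have "r \<in> {0,1,2,3}" unfolding insert_iff empty_iff by presburger
  ultimately show ?thesis using assms unfolding chi4_def r_def[symmetric] by auto
qed

text \<open>Here 5^2 = 24 + 1, so e = 1, and the multiplier is \<open>chi12 5\<close>, which is
  -1.\<close>

lemma section_5_1_euler_fn: "fps_section 5 1 euler_fn = - (fps_X * (euler_fn oo fps_X ^ 25))"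
proof -
  have "fps_section 5 1 euler_fn = fps_const (-1) * (fps_X ^ 1 * (euler_fn oo fps_X ^ (5 ^ 2)))"
    by (rule fps_section_quadratic[where c = 24 and h = "\<lambda>x. of_int (chi12 x)"])
      (simp_all add: euler_fn_nth_square euler_fn_nth_nonsquare chi12_5)
  then show ?thesis by (simp flip: fps_const_neg)
qed

text \<open>The weight x in Jacobi's series is what puts the factor p into the multiplier; squaring
  the section will give p^2.\<close>

lemma section_euler_fn_cube:
  assumes "prime p" "p * p = 8 * e + 1" "e < p" "p mod 4 = 1 \<or> p mod 4 = 3"
  shows "fps_section p e (euler_fn ^ 3) =
    fps_const (of_int (chi4 p) * of_nat p) * (fps_X ^ e * ((euler_fn oo fps_X ^ (p ^ 2)) ^ 3))"
proof -
  have "fps_section p e (euler_fn ^ 3) =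
    fps_const (of_int (chi4 p) * of_nat p) * (fps_X ^ e * ((euler_fn ^ 3) oo fps_X ^ (p ^ 2)))"
    using assms
    by (intro fps_section_quadratic[where c = 8 and h = "\<lambda>x. of_int (chi4 x) * of_nat x"])
      (simp_all add: euler_fn_cube_nth_square euler_fn_cube_nth_nonsquare chi4_mult)
  moreover have "(euler_fn ^ 3) oo fps_X ^ (p ^ 2) = (euler_fn oo fps_X ^ (p ^ 2)) ^ 3"
    using prime_gt_0_nat[OF assms(1)] by (intro fps_compose_power[symmetric]) simp
  ultimately show ?thesis by simp
qed

lemma square_mod_5: "(x * x :: nat) mod 5 \<in> {0, 1, 4}"
proof -
  define r where "r = x mod 5"
  have "(x * x) mod 5 = (r * r) mod 5" by (simp add: r_def mod_simps)
  moreover have "r < 5" by (simp add: r_def)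
  then have "r \<in> {0,1,2,3,4}" unfolding insert_iff empty_iff by presburger
  ultimately show ?thesis by auto
qed

lemma square_mod_7: "(x * x :: nat) mod 7 \<in> {0, 1, 2, 4}"
proof -
  define r where "r = x mod 7"
  have "(x * x) mod 7 = (r * r) mod 7" by (simp add: r_def mod_simps)
  moreover have "r < 7" by (simp add: r_def)
  then have "r \<in> {0,1,2,3,4,5,6}" unfolding insert_iff empty_iff by presburger
  ultimately show ?thesis by auto
qed

lemma square_mod_3: "(x * x :: nat) mod 3 \<in> {0, 1}"
proof -
  define r where "r = x mod 3"
  have "(x * x) mod 3 = (r * r) mod 3" by (simp add: r_def mod_simps)
  moreover have "r < 3" by (simp add: r_def)
  then have "r \<in> {0,1,2}" unfolding insert_iff empty_iff by presburger
  ultimately show ?thesis by auto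
qed

lemma section_euler_fn_zero:
  assumes "\<And>x N. N mod p = r \<Longrightarrow> x * x \<noteq> 24 * N + 1"
  shows "fps_section p r euler_fn = 0"
  using assms by (intro fps_section_zeroI euler_fn_nth_nonsquare)

lemma section_euler_fn_cube_zero:
  assumes "\<And>x N. N mod p = r \<Longrightarrow> x * x \<noteq> 8 * N + 1"
  shows "fps_section p r (euler_fn ^ 3) = 0"
  using assms by (intro fps_section_zeroI euler_fn_cube_nth_nonsquare)

lemma mult_self_cube:
  fixes A B C :: "'a::comm_ring_1"
  shows "(A * (B * C ^ 3)) * (A * (B * C ^ 3)) = (A * A) * ((B * B) * C ^ 6)"
proof -
  have "C ^ 6 = C ^ 3 * C ^ 3" by (simp flip: power_add)
  then show ?thesis by (simp only: mult_ac)
qed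

text \<open>Class 2 of f^3 is empty since 8N + 1 would be 2 modulo 3, a nonresidue. So class 2 of
  f^6 arises only as 1 + 1, with multiplier (-3)^2.\<close>

lemma section_3_2_euler_fn_6:
  "fps_section 3 2 (euler_fn ^ 6) = fps_const 9 * (fps_X ^ 2 * ((euler_fn ^ 6) oo fps_X ^ 9))"
proof -
  have z: "fps_section 3 2 (euler_fn ^ 3) = 0"
  proof (rule section_euler_fn_cube_zero)
    fix x N :: nat assume "N mod 3 = 2"
    then have "(8 * N + 1) mod 3 = 2" by presburger
    then show "x * x \<noteq> 8 * N + 1" using square_mod_3[of x] by auto
  qed
  have "fps_section 3 1 (euler_fn ^ 3) =
    fps_const (-3) * (fps_X ^ 1 * ((euler_fn oo fps_X ^ (3 ^ 2)) ^ 3))"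
    by (subst section_euler_fn_cube) (simp_all add: chi4_def)
  then have s1: "fps_section 3 1 (euler_fn ^ 3) =
    fps_const (-3) * (fps_X * ((euler_fn oo fps_X ^ 9) ^ 3))" by simp
  have e6: "euler_fn ^ 6 = euler_fn ^ 3 * euler_fn ^ 3" by (simp flip: power_add)
  have "{..<3::nat} = {0,1,2}" by auto
  then have "fps_section 3 2 (euler_fn ^ 6) =
    fps_section 3 1 (euler_fn ^ 3) * fps_section 3 1 (euler_fn ^ 3)"
    unfolding e6 by (subst fps_section_mult) (simp_all add: z)
  also have "\<dots> = (fps_const (-3) * fps_const (-3)) * (fps_X ^ 2 * (euler_fn oo fps_X ^ 9) ^ 6)"
    unfolding s1 mult_self_cube by (simp add: power2_eq_square)
  also have "(euler_fn oo fps_X ^ 9) ^ 6 = (euler_fn ^ 6) oo fps_X ^ 9"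
    by (intro fps_compose_power) simp
  finally show ?thesis by simp
qed

text \<open>Classes 2, 4 and 5 of f^3 are empty, since 3, 5, 6 are the nonresidues modulo 7. Every
  way to write 5 as a sum of two classes uses one of them, except 6 + 6.\<close>

lemma section_7_5_euler_fn_6:
  "fps_section 7 5 (euler_fn ^ 6) = fps_const 49 * (fps_X ^ 12 * ((euler_fn ^ 6) oo fps_X ^ 49))"
proof -
  have z: "fps_section 7 r (euler_fn ^ 3) = 0" if "r = 2 \<or> r = 4 \<or> r = 5" for r
  proof (rule section_euler_fn_cube_zero)
    fix x N :: nat assume "N mod 7 = r"
    then have "(8 * N + 1) mod 7 \<in> {3, 5, 6}" using that
      unfolding insert_iff empty_iff by presburger
    then show "x * x \<noteq> 8 * N + 1" using square_mod_7[of x] by auto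
  qed
  have "fps_section 7 6 (euler_fn ^ 3) =
    fps_const (-7) * (fps_X ^ 6 * ((euler_fn oo fps_X ^ (7 ^ 2)) ^ 3))"
    by (subst section_euler_fn_cube) (simp_all add: chi4_def)
  then have s1: "fps_section 7 6 (euler_fn ^ 3) =
    fps_const (-7) * (fps_X ^ 6 * ((euler_fn oo fps_X ^ 49) ^ 3))" by simp
  have e6: "euler_fn ^ 6 = euler_fn ^ 3 * euler_fn ^ 3" by (simp flip: power_add)
  have "{..<7::nat} = {0,1,2,3,4,5,6}" by auto
  then have "fps_section 7 5 (euler_fn ^ 6) =
    fps_section 7 6 (euler_fn ^ 3) * fps_section 7 6 (euler_fn ^ 3)"
    unfolding e6 by (subst fps_section_mult) (simp_all add: z)
  also have "\<dots> = (fps_const (-7) * fps_const (-7)) * (fps_X ^ 12 * (euler_fn oo fps_X ^ 49) ^ 6)"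
    unfolding s1 mult_self_cube by (simp flip: power_add)
  also have "(euler_fn oo fps_X ^ 49) ^ 6 = (euler_fn ^ 6) oo fps_X ^ 49"
    by (intro fps_compose_power) simp
  finally show ?thesis by simp
qed

section \<open>Dissection of powers of the Euler function modulo 5\<close>

lemma section_5_mult:
  fixes F G :: "'a::comm_ring_1 fps"
  defines "S \<equiv> \<lambda>r. fps_section 5 r F" and "T \<equiv> \<lambda>r. fps_section 5 r G"
  shows "fps_section 5 0 (F * G) = S 0 * T 0 + S 1 * T 4 + S 2 * T 3 + S 3 * T 2 + S 4 * T 1"
    and "fps_section 5 1 (F * G) = S 0 * T 1 + S 1 * T 0 + S 2 * T 4 + S 3 * T 3 + S 4 * T 2"
    and "fps_section 5 2 (F * G) = S 0 * T 2 + S 1 * T 1 + S 2 * T 0 + S 3 * T 4 + S 4 * T 3"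
    and "fps_section 5 3 (F * G) = S 0 * T 3 + S 1 * T 2 + S 2 * T 1 + S 3 * T 0 + S 4 * T 4"
    and "fps_section 5 4 (F * G) = S 0 * T 4 + S 1 * T 3 + S 2 * T 2 + S 3 * T 1 + S 4 * T 0"
proof -
  have "{..<5::nat} = {0,1,2,3,4}" by auto
  then show "fps_section 5 0 (F * G) = S 0 * T 0 + S 1 * T 4 + S 2 * T 3 + S 3 * T 2 + S 4 * T 1"
    and "fps_section 5 1 (F * G) = S 0 * T 1 + S 1 * T 0 + S 2 * T 4 + S 3 * T 3 + S 4 * T 2"
    and "fps_section 5 2 (F * G) = S 0 * T 2 + S 1 * T 1 + S 2 * T 0 + S 3 * T 4 + S 4 * T 3"
    and "fps_section 5 3 (F * G) = S 0 * T 3 + S 1 * T 2 + S 2 * T 1 + S 3 * T 0 + S 4 * T 4"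
    and "fps_section 5 4 (F * G) = S 0 * T 4 + S 1 * T 3 + S 2 * T 2 + S 3 * T 1 + S 4 * T 0"
    by (simp_all add: fps_section_mult S_def T_def add_ac)
qed

context
  fixes a b c :: "rat fps"
  assumes sec: "fps_section 5 0 euler_fn = a" "fps_section 5 1 euler_fn = b"
    "fps_section 5 2 euler_fn = c"
    "fps_section 5 3 euler_fn = 0" "fps_section 5 4 euler_fn = 0"
begin

lemma sections_5_euler_fn_2:
  "fps_section 5 0 (euler_fn ^ 2) = a ^ 2"
  "fps_section 5 1 (euler_fn ^ 2) = 2 * a * b"
  "fps_section 5 2 (euler_fn ^ 2) = b ^ 2 + 2 * a * c"
  "fps_section 5 3 (euler_fn ^ 2) = 2 * b * c"
  "fps_section 5 4 (euler_fn ^ 2) = c ^ 2"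
  unfolding power2_eq_square section_5_mult sec by (simp_all add: algebra_simps)

text \<open>Stated before the relation between a, b, c is available: it is the source of that
  relation.\<close>

lemma section_5_3_euler_fn_3: "fps_section 5 3 (euler_fn ^ 3) = b ^ 3 + 6 * a * b * c"
proof -
  have e: "euler_fn ^ 3 = euler_fn ^ 2 * euler_fn" by (simp add: power2_eq_square power3_eq_cube)
  show ?thesis
    unfolding e section_5_mult sec sections_5_euler_fn_2 by algebra
qed

context
  assumes ac: "a * c = - (b ^ 2)"
begin

text \<open>From here on each section is written in the normal form modulo ac = -b^2, in which no
  monomial contains both a and c. This keeps the products small on the way to the powers 6, 8 and
  14.\<close>

lemma sections_5_euler_fn_4:
  "fps_section 5 0 (euler_fn ^ 4) = a ^ 4 - 8 * b ^ 3 * c"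
  "fps_section 5 1 (euler_fn ^ 4) = 4 * a ^ 3 * b + 2 * b ^ 2 * c ^ 2"
  "fps_section 5 2 (euler_fn ^ 4) = 2 * a ^ 2 * b ^ 2 + 4 * b * c ^ 3"
  "fps_section 5 3 (euler_fn ^ 4) = c ^ 4 - 8 * a * b ^ 3"
  "fps_section 5 4 (euler_fn ^ 4) = - 5 * b ^ 4"
proof -
  have e: "euler_fn ^ 4 = euler_fn ^ 2 * euler_fn ^ 2" by (simp flip: power_add)
  show "fps_section 5 0 (euler_fn ^ 4) = a ^ 4 - 8 * b ^ 3 * c"
  "fps_section 5 1 (euler_fn ^ 4) = 4 * a ^ 3 * b + 2 * b ^ 2 * c ^ 2"
  "fps_section 5 2 (euler_fn ^ 4) = 2 * a ^ 2 * b ^ 2 + 4 * b * c ^ 3"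
  "fps_section 5 3 (euler_fn ^ 4) = c ^ 4 - 8 * a * b ^ 3"
  "fps_section 5 4 (euler_fn ^ 4) = - 5 * b ^ 4"
    unfolding e section_5_mult sections_5_euler_fn_2 using ac by algebra+
qed

lemma sections_5_euler_fn_6:
  "fps_section 5 0 (euler_fn ^ 6) = a ^ 6 + 6 * a * b ^ 5 + 9 * b ^ 2 * c ^ 4"
  "fps_section 5 1 (euler_fn ^ 6) = 6 * a ^ 5 * b + 41 * b ^ 6 + 6 * b * c ^ 5"
  "fps_section 5 2 (euler_fn ^ 6) = 9 * a ^ 4 * b ^ 2 + 6 * b ^ 5 * c + c ^ 6"
  "fps_section 5 3 (euler_fn ^ 6) = - 10 * a ^ 3 * b ^ 3 - 30 * b ^ 4 * c ^ 2"
  "fps_section 5 4 (euler_fn ^ 6) = - 30 * a ^ 2 * b ^ 4 - 10 * b ^ 3 * c ^ 3"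
proof -
  have e: "euler_fn ^ 6 = euler_fn ^ 4 * euler_fn ^ 2" by (simp flip: power_add)
  show "fps_section 5 0 (euler_fn ^ 6) = a ^ 6 + 6 * a * b ^ 5 + 9 * b ^ 2 * c ^ 4"
  "fps_section 5 1 (euler_fn ^ 6) = 6 * a ^ 5 * b + 41 * b ^ 6 + 6 * b * c ^ 5"
  "fps_section 5 2 (euler_fn ^ 6) = 9 * a ^ 4 * b ^ 2 + 6 * b ^ 5 * c + c ^ 6"
  "fps_section 5 3 (euler_fn ^ 6) = - 10 * a ^ 3 * b ^ 3 - 30 * b ^ 4 * c ^ 2"
  "fps_section 5 4 (euler_fn ^ 6) = - 30 * a ^ 2 * b ^ 4 - 10 * b ^ 3 * c ^ 3"
    unfolding e section_5_mult sections_5_euler_fn_2 sections_5_euler_fn_4 using ac by algebra+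
qed

lemma sections_5_euler_fn_8:
  "fps_section 5 0 (euler_fn ^ 8) = a ^ 8 - 56 * a ^ 3 * b ^ 5 + 112 * b ^ 6 * c ^ 2 +
    8 * b * c ^ 7"
  "fps_section 5 1 (euler_fn ^ 8) = 8 * a ^ 7 * b + 112 * a ^ 2 * b ^ 6 - 56 * b ^ 5 * c ^ 3 +
    c ^ 8"
  "fps_section 5 2 (euler_fn ^ 8) = 20 * a ^ 6 * b ^ 2 + 120 * a * b ^ 7 - 70 * b ^ 4 * c ^ 4"
  "fps_section 5 3 (euler_fn ^ 8) = - 125 * b ^ 8"
  "fps_section 5 4 (euler_fn ^ 8) = - 70 * a ^ 4 * b ^ 4 + 120 * b ^ 7 * c + 20 * b ^ 2 * c ^ 6"
proof -
  have e: "euler_fn ^ 8 = euler_fn ^ 6 * euler_fn ^ 2" by (simp flip: power_add)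
  show "fps_section 5 0 (euler_fn ^ 8) =
    a ^ 8 - 56 * a ^ 3 * b ^ 5 + 112 * b ^ 6 * c ^ 2 + 8 * b * c ^ 7"
  "fps_section 5 1 (euler_fn ^ 8) = 8 * a ^ 7 * b + 112 * a ^ 2 * b ^ 6 - 56 * b ^ 5 * c ^ 3 +
    c ^ 8"
  "fps_section 5 2 (euler_fn ^ 8) = 20 * a ^ 6 * b ^ 2 + 120 * a * b ^ 7 - 70 * b ^ 4 * c ^ 4"
  "fps_section 5 3 (euler_fn ^ 8) = - 125 * b ^ 8"
  "fps_section 5 4 (euler_fn ^ 8) = - 70 * a ^ 4 * b ^ 4 + 120 * b ^ 7 * c + 20 * b ^ 2 * c ^ 6"
    unfolding e section_5_mult sections_5_euler_fn_2 sections_5_euler_fn_6 using ac by algebra+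
qed

text \<open>In normal form all monomials containing a or c cancel, and the remaining coefficient is
  -5^6.\<close>

lemma section_5_4_euler_fn_14: "fps_section 5 4 (euler_fn ^ 14) = - 15625 * b ^ 14"
proof -
  have e: "euler_fn ^ 14 = euler_fn ^ 8 * euler_fn ^ 6" by (simp flip: power_add)
  show ?thesis
    unfolding e section_5_mult sections_5_euler_fn_6 sections_5_euler_fn_8 using ac by algebra
qed

end

end

lemma sections_5_euler_fn:
  shows "fps_section 5 3 (euler_fn ^ 8) =
    fps_const (- 125) * (fps_X ^ 8 * ((euler_fn ^ 8) oo fps_X ^ 25))"
    and "fps_section 5 4 (euler_fn ^ 14) =
      fps_const (- 15625) * (fps_X ^ 14 * ((euler_fn ^ 14) oo fps_X ^ 25))"
proof -
  define G where "G = euler_fn oo fps_X ^ 25"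
  define a b c where "a = fps_section 5 0 euler_fn" and "b = - (fps_X * G)" and
    "c = fps_section 5 2 euler_fn"
  have G: "G ^ m = (euler_fn ^ m) oo fps_X ^ 25" for m
    unfolding G_def by (intro fps_compose_power) simp
  have sec: "fps_section 5 0 euler_fn = a" "fps_section 5 1 euler_fn = b"
    "fps_section 5 2 euler_fn = c"
    by (simp_all add: a_def b_def c_def G_def section_5_1_euler_fn[simplified])
  have zero: "fps_section 5 3 euler_fn = 0" "fps_section 5 4 euler_fn = 0"
  proof -
    have "x * x \<noteq> 24 * N + 1" if "N mod 5 = 3 \<or> N mod 5 = 4" for x N :: nat
    proof -
      have "(24 * N + 1) mod 5 \<in> {2, 3}" using that unfolding insert_iff empty_iff by presburger
      then show ?thesis using square_mod_5[of x] by auto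
    qed
    then show "fps_section 5 3 euler_fn = 0" "fps_section 5 4 euler_fn = 0"
      by (auto intro!: section_euler_fn_zero)
  qed
  note S = sec zero
  have "G $ 0 \<noteq> 0"
    using p_gen_eq_below[of 0 1] by (simp add: G_def fps_eq_below_def)
  then have "b \<noteq> 0" by (auto simp: b_def)
  have "fps_section 5 3 (euler_fn ^ 3) =
    fps_const 5 * (fps_X ^ 3 * ((euler_fn oo fps_X ^ (5 ^ 2)) ^ 3))"
    by (subst section_euler_fn_cube) (simp_all add: chi4_def)
  \<comment> \<open>Jacobi's term 5 X^3 G^3 is -5 b^3, so 6abc = -6 b^3; one factor b is cancelled
    because the constant term of G is nonzero.\<close>
  then have "b ^ 3 + 6 * a * b * c = - 5 * b ^ 3"
    unfolding section_5_3_euler_fn_3[OF S]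
    by (simp add: b_def G_def power_mult_distrib flip: numeral_fps_const)
  then have "b * (a * c) = b * (- (b ^ 2))" by algebra
  then have ac: "a * c = - (b ^ 2)"
    using \<open>b \<noteq> 0\<close> by (simp only: mult_cancel_left simp_thms)
  show "fps_section 5 3 (euler_fn ^ 8) =
    fps_const (- 125) * (fps_X ^ 8 * ((euler_fn ^ 8) oo fps_X ^ 25))"
    unfolding sections_5_euler_fn_8[OF S ac]
    by (simp add: b_def power_mult_distrib G flip: neg_numeral_fps_const)
  show "fps_section 5 4 (euler_fn ^ 14) =
    fps_const (- 15625) * (fps_X ^ 14 * ((euler_fn ^ 14) oo fps_X ^ 25))"
    unfolding section_5_4_euler_fn_14[OF S ac]
    by (simp add: b_def power_mult_distrib G flip: neg_numeral_fps_const)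
qed

section \<open>Power series over the localisation at a prime\<close>

text \<open>The ideal generated by \<open>p^k\<close> in the localisation of the integers at \<open>p\<close>.\<close>

definition ploc :: "nat \<Rightarrow> nat \<Rightarrow> rat set" where
  "ploc p k = {of_int (int p ^ k * a) / of_int d | a d. d \<noteq> 0 \<and> coprime d (int p)}"

lemma plocI: "x = of_int (int p ^ k * a) / of_int d \<Longrightarrow> d \<noteq> 0 \<Longrightarrow> coprime d (int p) \<Longrightarrow> x \<in> ploc p k"
  unfolding ploc_def by blast

lemma plocE:
  assumes "x \<in> ploc p k"
  obtains a d where "x = of_int (int p ^ k * a) / of_int d" "d \<noteq> 0" "coprime d (int p)"
  using assms unfolding ploc_def by blast

lemma ploc_of_int: "int p ^ k dvd a \<Longrightarrow> of_int a \<in> ploc p k"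
  by (elim dvdE, rule plocI[where d = 1]) auto

lemma ploc_of_nat [simp]: "of_nat n \<in> ploc p 0"
  using ploc_of_int[of p 0 "int n"] by simp

lemma ploc_0 [simp]: "0 \<in> ploc p k"
  using ploc_of_int[of p k 0] by simp

lemma ploc_1 [simp]: "1 \<in> ploc p 0"
  using ploc_of_int[of p 0 1] by simp

lemma ploc_add:
  assumes "x \<in> ploc p k" "y \<in> ploc p k"
  shows "x + y \<in> ploc p k"
proof -
  obtain a d b e where "x = of_int (int p ^ k * a) / of_int d" "d \<noteq> 0" "coprime d (int p)"
    "y = of_int (int p ^ k * b) / of_int e" "e \<noteq> 0" "coprime e (int p)"
    using assms by (elim plocE)
  then show ?thesis
    by (intro plocI[where a = "a * e + b * d" and d = "d * e"]) (simp_all add: field_simps)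
qed

lemma ploc_uminus:
  assumes "x \<in> ploc p k"
  shows "- x \<in> ploc p k"
proof -
  obtain a d where "x = of_int (int p ^ k * a) / of_int d" "d \<noteq> 0" "coprime d (int p)"
    using assms by (elim plocE)
  then show ?thesis by (intro plocI[where a = "- a" and d = d]) simp_all
qed

lemma ploc_mult:
  assumes "x \<in> ploc p j" "y \<in> ploc p k"
  shows "x * y \<in> ploc p (j + k)"
proof -
  obtain a d b e where "x = of_int (int p ^ j * a) / of_int d" "d \<noteq> 0" "coprime d (int p)"
    "y = of_int (int p ^ k * b) / of_int e" "e \<noteq> 0" "coprime e (int p)"
    using assms by (elim plocE)
  then show ?thesis
    by (intro plocI[where a = "a * b" and d = "d * e"]) (simp_all add: field_simps power_add)
qed

lemma ploc_mono:
  assumes "x \<in> ploc p k" "j \<le> k"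
  shows "x \<in> ploc p j"
proof -
  obtain a d where x: "x = of_int (int p ^ k * a) / of_int d" "d \<noteq> 0" "coprime d (int p)"
    using assms by (elim plocE)
  have "int p ^ k = int p ^ j * int p ^ (k - j)" using assms by (simp flip: power_add)
  then show ?thesis using x by (intro plocI[where a = "int p ^ (k - j) * a" and d = d]) simp_all
qed

lemma ploc_sum: "(\<And>i. i \<in> A \<Longrightarrow> f i \<in> ploc p k) \<Longrightarrow> sum f A \<in> ploc p k"
  by (induction A rule: infinite_finite_induct) (auto intro: ploc_add)

lemma ploc_divide_nat:
  assumes "x \<in> ploc p k" "b > 0" "coprime b p"
  shows "x / of_nat b \<in> ploc p k"
proof -
  have "1 / of_nat b \<in> ploc p 0"
    using assms by (intro plocI[where a = 1 and d = "int b"]) (simp_all add: coprime_int_iff)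
  from ploc_mult[OF assms(1) this] show ?thesis by simp
qed

text \<open>For the reduced fraction n/m, cross-multiplication gives n d = p^k a m with d prime to
  p, so p^k divides n.\<close>

lemma ploc_imp_rat_cong_0:
  assumes "x \<in> ploc p k"
  shows "rat_cong_0 x (int p ^ k)"
proof -
  obtain a d where x: "x = of_int (int p ^ k * a) / of_int d" "d \<noteq> 0" "coprime d (int p)"
    using assms by (elim plocE)
  obtain n m where nm: "quotient_of x = (n, m)" by (cases "quotient_of x")
  have m: "m > 0" using quotient_of_denom_pos[OF nm] .
  have "x = of_int n / of_int m" using quotient_of_div[OF nm] .
  with x m have "(of_int n :: rat) * of_int d = of_int (int p ^ k * a) * of_int m"
    by (simp add: field_simps)
  then have "n * d = int p ^ k * a * m" by (metis of_int_eq_iff of_int_mult)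
  then have "int p ^ k dvd n * d" by (simp add: mult.assoc)
  moreover have "coprime (int p ^ k) d" using x(3) by (simp add: coprime_commute)
  ultimately have "int p ^ k dvd n" by (simp add: coprime_dvd_mult_left_iff)
  then show ?thesis by (simp add: rat_cong_0_def nm)
qed

text \<open>Power series are congruent modulo p^k when their difference lies in this set.\<close>

definition fps_ploc :: "nat \<Rightarrow> nat \<Rightarrow> rat fps set" where
  "fps_ploc p k = {F. \<forall>n. F $ n \<in> ploc p k}"

lemma fps_plocI: "(\<And>n. F $ n \<in> ploc p k) \<Longrightarrow> F \<in> fps_ploc p k"
  by (simp add: fps_ploc_def)

lemma fps_plocD: "F \<in> fps_ploc p k \<Longrightarrow> F $ n \<in> ploc p k"
  by (simp add: fps_ploc_def)

lemma fps_ploc_0 [simp]: "0 \<in> fps_ploc p k"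
  by (simp add: fps_ploc_def)

lemma fps_ploc_1 [simp]: "1 \<in> fps_ploc p 0"
  by (simp add: fps_ploc_def)

lemma fps_ploc_add: "F \<in> fps_ploc p k \<Longrightarrow> G \<in> fps_ploc p k \<Longrightarrow> F + G \<in> fps_ploc p k"
  by (simp add: fps_ploc_def ploc_add)

lemma fps_ploc_mono: "F \<in> fps_ploc p k \<Longrightarrow> j \<le> k \<Longrightarrow> F \<in> fps_ploc p j"
  by (auto simp: fps_ploc_def intro: ploc_mono)

lemma fps_ploc_mult: "F \<in> fps_ploc p j \<Longrightarrow> G \<in> fps_ploc p k \<Longrightarrow> F * G \<in> fps_ploc p (j + k)"
  by (auto simp: fps_ploc_def fps_mult_nth intro!: ploc_sum ploc_mult)

lemma fps_ploc_sum: "(\<And>i. i \<in> A \<Longrightarrow> f i \<in> fps_ploc p k) \<Longrightarrow> sum f A \<in> fps_ploc p k"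
  by (auto simp: fps_ploc_def fps_sum_nth intro!: ploc_sum)

lemma fps_ploc_power: "F \<in> fps_ploc p j \<Longrightarrow> F ^ m \<in> fps_ploc p (j * m)"
  by (induction m) (auto simp: add.commute dest: fps_ploc_mult)

lemma fps_ploc_const: "c \<in> ploc p k \<Longrightarrow> fps_const c \<in> fps_ploc p k"
  by (simp add: fps_ploc_def)

lemma fps_ploc_X_power [simp]: "fps_X ^ n \<in> fps_ploc p 0"
  by (simp add: fps_ploc_def fps_X_power_nth)

lemma fps_ploc_compose_X_power: "F \<in> fps_ploc p k \<Longrightarrow> F oo fps_X ^ d \<in> fps_ploc p k"
  by (simp add: fps_ploc_def fps_nth_compose_X_power)

section \<open>Frobenius congruences for power series with p-integral coefficients\<close>

lemma freshman_dream:
  fixes x y :: "'a::comm_ring_1"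
  assumes "prime p"
  shows "(x + y) ^ p = x ^ p + y ^ p + of_nat p *
    (\<Sum>k=1..<p. of_nat ((p choose k) div p) * x ^ k * y ^ (p - k))"
proof -
  have p: "p > 1" using assms by (rule prime_gt_1_nat)
  have "{..p} = insert 0 (insert p {1..<p})" using p by auto
  then have "(x + y) ^ p = x ^ p + y ^ p + (\<Sum>k=1..<p. of_nat (p choose k) * x ^ k * y ^ (p - k))"
    using p unfolding binomial_ring by (simp add: add_ac)
  also have "(\<Sum>k=1..<p. of_nat (p choose k) * x ^ k * y ^ (p - k)) =
      of_nat p * (\<Sum>k=1..<p. of_nat ((p choose k) div p) * x ^ k * y ^ (p - k))"
    unfolding sum_distrib_left
  proof (intro sum.cong refl)
    fix k assume "k \<in> {1..<p}"
    then have "p dvd (p choose k)" using assms by (intro dvd_choose_prime) auto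
    then have "(p choose k) = p * ((p choose k) div p)" by simp
    then have "(of_nat (p choose k) :: 'a) = of_nat p * of_nat ((p choose k) div p)"
      by (metis of_nat_mult)
    then show "of_nat (p choose k) * x ^ k * y ^ (p - k) =
      of_nat p * (of_nat ((p choose k) div p) * x ^ k * y ^ (p - k))"
      by (simp add: mult.assoc)
  qed
  finally show ?thesis .
qed

lemma fermat_int:
  assumes "prime p"
  shows "int p dvd a ^ p - a"
proof -
  have step: "int p dvd ((b + 1) ^ p - (b + 1)) - (b ^ p - b)" for b
    unfolding freshman_dream[OF assms] by simp
  show ?thesis
  proof (induction a rule: int_induct[where k = 0])
    case base
    show ?case using prime_gt_0_nat[OF assms] by (simp add: zero_power)
  next
    case (step1 i)
    then show ?case using step[of i] by (metis diff_add_cancel dvd_add)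
  next
    case (step2 i)
    from dvd_diff[OF step2(2) step[of "i - 1"]] show ?case by (simp add: algebra_simps)
  qed
qed

lemma fermat_ploc:
  assumes "prime p" "x \<in> ploc p 0"
  shows "x ^ p - x \<in> ploc p 1"
proof -
  obtain a d where x: "x = of_int a / of_int d" "d \<noteq> 0" "coprime d (int p)"
    using assms(2) by (elim plocE) auto
  \<comment> \<open>Fermat's theorem for numerator and denominator, combined into the numerator of
    x^p - x.\<close>
  have "int p dvd (a ^ p - a) * d - a * (d ^ p - d)"
    using fermat_int[OF assms(1)] by (intro dvd_diff) simp_all
  moreover have "(a ^ p - a) * d - a * (d ^ p - d) = a ^ p * d - a * d ^ p"
    by (simp add: algebra_simps)
  ultimately obtain z where z: "a ^ p * d - a * d ^ p = int p * z" by (auto elim: dvdE)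
  have "x ^ p - x = of_int (a ^ p * d - a * d ^ p) / of_int (d ^ p * d)"
    using x(2) by (simp add: x(1) field_simps)
  then show ?thesis unfolding z
    using x by (intro plocI[where a = z and d = "d ^ p * d"]) simp_all
qed

lemma fps_ploc_of_nat_self: "of_nat p \<in> fps_ploc p 1"
  unfolding fps_of_nat[symmetric] using ploc_of_int[of p 1 "int p"] by (intro fps_ploc_const) simp

text \<open>Every cross term has at least one factor G, worth p^j, and its binomial coefficient
  supplies one more p.\<close>

lemma fps_ploc_freshman:
  assumes "prime p" "F \<in> fps_ploc p 0" "G \<in> fps_ploc p j"
  shows "(F + G) ^ p - (F ^ p + G ^ p) \<in> fps_ploc p (Suc j)"
proof -
  have "of_nat ((p choose k) div p) * F ^ k * G ^ (p - k) \<in> fps_ploc p j" if "k \<in> {1..<p}" for k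
  proof -
    have "of_nat ((p choose k) div p) * F ^ k \<in> fps_ploc p 0"
      using fps_ploc_mult[OF fps_ploc_const[OF ploc_of_nat] fps_ploc_power[OF assms(2)]]
      by (simp add: fps_of_nat)
    moreover have "G ^ (p - k) \<in> fps_ploc p j"
      using that by (intro fps_ploc_mono[OF fps_ploc_power[OF assms(3)]]) (simp add: Suc_le_eq)
    ultimately show ?thesis using fps_ploc_mult by fastforce
  qed
  then have "(\<Sum>k=1..<p. of_nat ((p choose k) div p) * F ^ k * G ^ (p - k)) \<in> fps_ploc p j"
    by (rule fps_ploc_sum)
  from fps_ploc_mult[OF fps_ploc_of_nat_self this] show ?thesis
    unfolding freshman_dream[OF assms(1)] by simp
qed

lemma fps_cutoff_Suc: "fps_cutoff (Suc n) F = fps_cutoff n F + fps_const (F $ n) * fps_X ^ n"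
  by (rule fps_ext) (auto simp: fps_X_power_nth less_Suc_eq)

text \<open>The series is built up one monomial at a time: sums are handled by the binomial theorem,
  coefficients by Fermat. Each coefficient depends on a truncation only.\<close>

lemma frobenius_fps_ploc:
  assumes p: "prime p" and F: "F \<in> fps_ploc p 0"
  shows "F ^ p - (F oo fps_X ^ p) \<in> fps_ploc p 1"
proof (rule fps_plocI)
  fix m
  have p0: "p > 0" using p by (rule prime_gt_0_nat)
  have cut: "fps_cutoff n F ^ p - (fps_cutoff n F oo fps_X ^ p) \<in> fps_ploc p 1" for n
  proof (induction n)
    case (Suc n)
    define c where "c = F $ n"
    define A where "A = fps_cutoff n F"
    have c: "c \<in> ploc p 0" using F by (simp add: c_def fps_plocD)
    have A: "A \<in> fps_ploc p 0" using F by (intro fps_plocI) (simp add: A_def fps_plocD)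
    have B: "fps_const c * fps_X ^ n \<in> fps_ploc p 0"
      using fps_ploc_mult[OF fps_ploc_const[OF c] fps_ploc_X_power] by simp
    have 1: "(A + fps_const c * fps_X ^ n) ^ p - (A ^ p + (fps_const c * fps_X ^ n) ^ p) \<in>
      fps_ploc p 1"
      using fps_ploc_freshman[OF p A B] by simp
    have "fps_const (c ^ p - c) * fps_X ^ (n * p) \<in> fps_ploc p 1"
      using fps_ploc_mult[OF fps_ploc_const[OF fermat_ploc[OF p c]] fps_ploc_X_power] by simp
    moreover have "(fps_const c * fps_X ^ n) oo fps_X ^ p = fps_const c * fps_X ^ (n * p)"
      using p0 by (intro fps_ext) (auto simp: fps_nth_compose_X_power fps_X_power_nth elim!: dvdE)
    then have "fps_const (c ^ p - c) * fps_X ^ (n * p) =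
      (fps_const c * fps_X ^ n) ^ p - ((fps_const c * fps_X ^ n) oo fps_X ^ p)"
      by (simp add: power_mult_distrib power_mult[symmetric] fps_const_power left_diff_distrib
        flip: fps_const_sub)
    ultimately have 2: "(fps_const c * fps_X ^ n) ^ p - ((fps_const c * fps_X ^ n) oo fps_X ^ p) \<in>
      fps_ploc p 1"
      by simp
    have "fps_cutoff (Suc n) F ^ p - (fps_cutoff (Suc n) F oo fps_X ^ p) =
      ((A + fps_const c * fps_X ^ n) ^ p - (A ^ p + (fps_const c * fps_X ^ n) ^ p))
      + (A ^ p - (A oo fps_X ^ p)) + ((fps_const c * fps_X ^ n) ^ p - ((fps_const c * fps_X ^ n)
        oo fps_X ^ p))"
      by (simp only: fps_cutoff_Suc A_def[symmetric] c_def[symmetric] fps_compose_add_distrib) simp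
    then show ?case using 1 2 Suc[folded A_def] by (simp only: fps_ploc_add)
  qed (use p0 in \<open>simp add: zero_power\<close>)
  have "fps_eq_below (Suc m) F (fps_cutoff (Suc m) F)" by (simp add: fps_eq_below_def)
  then have "fps_eq_below (Suc m) (F ^ p) (fps_cutoff (Suc m) F ^ p)" by (rule fps_eq_below_power)
  then have "(F ^ p) $ m = (fps_cutoff (Suc m) F ^ p) $ m" by (simp add: fps_eq_below_def)
  moreover have "(F oo fps_X ^ p) $ m = (fps_cutoff (Suc m) F oo fps_X ^ p) $ m"
    by (simp add: fps_nth_compose_X_power less_Suc_eq_le)
  ultimately have "(F ^ p - (F oo fps_X ^ p)) $ m =
    (fps_cutoff (Suc m) F ^ p - (fps_cutoff (Suc m) F oo fps_X ^ p)) $ m"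
    by simp
  then show "(F ^ p - (F oo fps_X ^ p)) $ m \<in> ploc p 1"
    using fps_plocD[OF cut] by metis
qed

text \<open>Expand (B + (A - B))^p: the last term is divisible by p^(jp), and jp \<ge> 2j \<ge> j +
  1.\<close>

lemma fps_ploc_power_diff:
  assumes "prime p" "A \<in> fps_ploc p 0" "B \<in> fps_ploc p 0" "A - B \<in> fps_ploc p j" "j \<ge> 1"
  shows "A ^ p - B ^ p \<in> fps_ploc p (Suc j)"
proof -
  have "(B + (A - B)) ^ p - (B ^ p + (A - B) ^ p) \<in> fps_ploc p (Suc j)"
    using assms by (intro fps_ploc_freshman)
  moreover have "(A - B) ^ p \<in> fps_ploc p (Suc j)"
  proof (rule fps_ploc_mono[OF fps_ploc_power[OF assms(4)]])
    have "j * 2 \<le> j * p" using prime_ge_2_nat[OF assms(1)] by (intro mult_le_mono2)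
    then show "Suc j \<le> j * p" using assms(5) by linarith
  qed
  ultimately have "((B + (A - B)) ^ p - (B ^ p + (A - B) ^ p)) + (A - B) ^ p \<in> fps_ploc p (Suc j)"
    by (rule fps_ploc_add)
  then show ?thesis by simp
qed

lemma fps_ploc_power_prime_power:
  assumes "prime p" "G \<in> fps_ploc p 0"
  shows "G ^ (p ^ Suc k) - (G oo fps_X ^ p) ^ (p ^ k) \<in> fps_ploc p (Suc k)"
proof (induction k)
  case 0
  show ?case using frobenius_fps_ploc[OF assms] by simp
next
  case (Suc k)
  have G: "G ^ m \<in> fps_ploc p 0" "(G oo fps_X ^ p) ^ m \<in> fps_ploc p 0" for m
    using fps_ploc_power[OF assms(2)] fps_ploc_power[OF fps_ploc_compose_X_power[OF assms(2)]]
      by simp_all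
  have "(G ^ (p ^ Suc k)) ^ p - ((G oo fps_X ^ p) ^ (p ^ k)) ^ p \<in> fps_ploc p (Suc (Suc k))"
    using assms(1) G Suc by (intro fps_ploc_power_diff) simp_all
  then show ?case by (simp only: power_mult[symmetric] power_Suc2)
qed

section \<open>Integrality of the b-th root of an integral series\<close>

lemma fps_eq_below_X_power_mult: "fps_eq_below (Suc n) (fps_X ^ n * F)
  (fps_const (F $ 0) * fps_X ^ n)"
  by (auto simp: fps_eq_below_def fps_X_power_mult_nth fps_X_power_nth)

lemma fps_eq_below_add:
  "fps_eq_below d F G \<Longrightarrow> fps_eq_below d F' G' \<Longrightarrow> fps_eq_below d (F + F') (G + G')"
  by (simp add: fps_eq_below_def)

text \<open>First-order expansion: modulo X^(n+1) the perturbation enters linearly, and the constant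
  term 1 makes its factor exactly m.\<close>

lemma fps_eq_below_power_add:
  assumes "G $ 0 = 1" "n > 0"
  shows "fps_eq_below (Suc n) ((G + fps_const c * fps_X ^ n) ^ m)
    (G ^ m + fps_const (of_nat m * c) * fps_X ^ n)"
proof (induction m)
  case (Suc m)
  let ?e = "fps_eq_below (Suc n)"
  let ?X = "fps_X ^ n"
  have "?e ((G + fps_const c * ?X) ^ Suc m)
    ((G + fps_const c * ?X) * (G ^ m + fps_const (of_nat m * c) * ?X))"
    unfolding power_Suc using Suc by (rule fps_eq_below_mult[OF fps_eq_below_refl])
  also have "(G + fps_const c * ?X) * (G ^ m + fps_const (of_nat m * c) * ?X) =
     G ^ Suc m + ?X * (fps_const c * G ^ m + fps_const (of_nat m * c) * G + fps_const (c * (of_nat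
       m * c)) * ?X)"
    by (simp add: algebra_simps flip: fps_const_mult)
  also have "?e \<dots> (G ^ Suc m + fps_const
    ((fps_const c * G ^ m + fps_const (of_nat m * c) * G + fps_const (c * (of_nat m *
      c)) * ?X) $ 0) * ?X)"
    by (rule fps_eq_below_add[OF fps_eq_below_refl fps_eq_below_X_power_mult])
  also have "(fps_const c * G ^ m + fps_const (of_nat m * c) * G +
    fps_const (c * (of_nat m * c)) * ?X) $ 0 = of_nat (Suc m) * c"
    using assms by (simp add: fps_power_zeroth zero_power algebra_simps)
  finally show ?case .
qed simp

text \<open>For n > 0 the n-th coefficient of g^b h = 1 reads b g_n + (an integral expression in
  earlier coefficients) = 0, and b is invertible at p.\<close>

lemma fps_ploc_root:
  assumes "h \<in> fps_ploc p 0" "h $ 0 = 1" "g $ 0 = 1" "g ^ b * h = 1" "b > 0" "coprime b p"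
  shows "g \<in> fps_ploc p 0"
proof (rule fps_plocI)
  fix n show "g $ n \<in> ploc p 0"
  proof (induction n rule: less_induct)
    case (less n)
    show ?case
    proof (cases "n = 0")
      case False
      define A where "A = fps_cutoff n g"
      have A: "A \<in> fps_ploc p 0" using less by (intro fps_plocI) (simp add: A_def)
      have A0: "A $ 0 = 1" using False assms(3) by (simp add: A_def)
      have "fps_eq_below (Suc n) g (A + fps_const (g $ n) * fps_X ^ n)"
        unfolding A_def fps_cutoff_Suc[symmetric] by (simp add: fps_eq_below_def)
      then have "fps_eq_below (Suc n) (g ^ b) ((A + fps_const (g $ n) * fps_X ^ n) ^ b)"
        by (rule fps_eq_below_power)
      also have "fps_eq_below (Suc n) ((A + fps_const (g $ n) * fps_X ^ n) ^ b)
        (A ^ b + fps_const (of_nat b * g $ n) * fps_X ^ n)"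
        using A0 False by (intro fps_eq_below_power_add) simp_all
      finally have "fps_eq_below (Suc n) (g ^ b * h)
        ((A ^ b + fps_const (of_nat b * g $ n) * fps_X ^ n) * h)"
        by (rule fps_eq_below_mult[OF _ fps_eq_below_refl])
      then have "(1 :: rat fps) $ n = ((A ^ b + fps_const (of_nat b * g $ n) * fps_X ^ n) * h) $ n"
        unfolding assms(4) fps_eq_below_def by blast
      also have "\<dots> = (A ^ b * h) $ n + of_nat b * g $ n"
        by (simp add: distrib_right mult.assoc fps_X_power_mult_nth assms(2))
      finally have "g $ n = (- (A ^ b * h) $ n) / of_nat b"
        using assms(5) False by (simp add: field_simps)
      moreover have "A ^ b * h \<in> fps_ploc p 0"
        using fps_ploc_mult[OF fps_ploc_power[OF A] assms(1)] by simp
      ultimately show ?thesis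
        using assms(5,6) fps_plocD by (simp only:) (intro ploc_divide_nat, simp_all add:
          ploc_uminus)
    qed (simp add: assms)
  qed
qed

section \<open>The congruences\<close>

lemma fps_compose_X_power_X_power:
  assumes "a > 0" "b > 0"
  shows "(F oo fps_X ^ a) oo fps_X ^ b = F oo (fps_X ^ (a * b) :: 'a::idom fps)"
proof (rule fps_ext)
  fix n
  have "a * b dvd n \<longleftrightarrow> b dvd n \<and> a dvd n div b"
    using assms by (metis dvd_div_iff_mult dvd_mult_right mult.commute mult_is_0 not_gr_zero)
  then show "((F oo fps_X ^ a) oo fps_X ^ b) $ n = (F oo (fps_X ^ (a * b))) $ n"
    by (simp add: fps_nth_compose_X_power div_mult2_eq mult.commute[of a b])
qed

lemma euler_fn_ploc: "euler_fn \<in> fps_ploc p 0"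
proof (rule fps_plocI)
  fix N
  show "euler_fn $ N \<in> ploc p 0"
  proof (cases "\<exists>x. x * x = 24 * N + 1")
    case True
    then show ?thesis using euler_fn_nth_square ploc_of_int[of p 0] by fastforce
  qed (simp add: euler_fn_nth_nonsquare)
qed

text \<open>A series in q^p lies in class 0, so it acts as a scalar on the sections.\<close>

lemma fps_section_mult_compose:
  assumes "r < p"
  shows "fps_section p r (F * (K oo fps_X ^ p)) = fps_section p r F * (K oo fps_X ^ p)"
proof -
  have sec: "fps_section p i (K oo fps_X ^ p) = (if i = 0 then K oo fps_X ^ p else 0)" for i
    by (rule fps_ext) (auto simp: fps_section_nth fps_nth_compose_X_power)
  have "(r + p - i) mod p = 0 \<longleftrightarrow> i = r" if "i < p" for i
  proof (cases "i \<le> r")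
    case True
    then have "r + p - i = (r - i) + p" by simp
    moreover have "(r - i + p) mod p = r - i" using assms by simp
    ultimately have "(r + p - i) mod p = r - i" by (simp only:)
    then show ?thesis using True by auto
  next
    case False
    then show ?thesis using assms that by simp
  qed
  then have "(\<Sum>i<p. fps_section p i F * fps_section p ((r + p - i) mod p) (K oo fps_X ^ p)) =
      (\<Sum>i<p. if i = r then fps_section p r F * (K oo fps_X ^ p) else 0)"
    unfolding sec by (intro sum.cong) auto
  then show ?thesis using assms by (simp add: fps_section_mult)
qed

text \<open>The substitution N = p^2 M + e iterated s times. It starts from e mod p because the last
  step of the descent fixes only the class of N modulo p.\<close>

primrec offset :: "nat \<Rightarrow> nat \<Rightarrow> nat \<Rightarrow> nat" where
  "offset p e 0 = e mod p"
| "offset p e (Suc s) = p ^ 2 * offset p e s + e"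

context
  fixes p e :: nat and F G :: "rat fps" and l :: rat
  assumes p: "prime p" and F: "F \<in> fps_ploc p 0" and G: "G \<in> fps_ploc p 0" and l: "l \<in> ploc p 2"
    and sec: "fps_section p (e mod p) F = fps_const l * (fps_X ^ e * (F oo fps_X ^ (p ^ 2)))"
begin

text \<open>Replacing the power of G by K(q^p) lets the dissection of F act and produce l. As l is
  divisible by p^2, K is needed only modulo p^k, so K can be replaced by a series in q^p as well,
  which gives q^(p^2).\<close>

lemma section_mult_power_cong:
  assumes "N mod p = e mod p"
  shows "(F * G ^ (p ^ Suc (Suc k))) $ N
      - (fps_const l * (fps_X ^ e * ((F * G ^ (p ^ k)) oo fps_X ^ (p ^ 2)))) $ N \<in> ploc
        p (Suc (Suc k))"
proof -
  have p0: "p > 0" using p by (rule prime_gt_0_nat)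
  define K where "K = G ^ (p ^ Suc k)"
  define L where "L = fps_const l * (fps_X ^ e * (F oo fps_X ^ (p ^ 2)))"
  have pow: "(H oo fps_X ^ p) ^ m = (H ^ m) oo fps_X ^ p" for H :: "rat fps" and m
    using p0 by (intro fps_compose_power) simp
  have "G ^ (p ^ Suc (Suc k)) - (K oo fps_X ^ p) \<in> fps_ploc p (Suc (Suc k))"
    using fps_ploc_power_prime_power[OF p G, of "Suc k"] by (simp only: pow K_def)
  from fps_ploc_mult[OF F this]
  have 1: "(F * G ^ (p ^ Suc (Suc k))) $ N - (F * (K oo fps_X ^ p)) $ N \<in> ploc p (Suc (Suc k))"
    by (auto dest: fps_plocD[where n = N] simp: right_diff_distrib)
  have "(F * (K oo fps_X ^ p)) $ N = fps_section p (e mod p) (F * (K oo fps_X ^ p)) $ N"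
    using assms by (simp add: fps_section_nth)
  also have "\<dots> = (L * (K oo fps_X ^ p)) $ N"
    using p0 by (simp only: fps_section_mult_compose mod_less_divisor sec L_def)
  finally have 2: "(F * (K oo fps_X ^ p)) $ N = (L * (K oo fps_X ^ p)) $ N" .
  have "K - (G ^ (p ^ k) oo fps_X ^ p) \<in> fps_ploc p (Suc k)"
    using fps_ploc_power_prime_power[OF p G, of k] by (simp only: pow K_def)
  then have "K - (G ^ (p ^ k) oo fps_X ^ p) \<in> fps_ploc p k"
    by (rule fps_ploc_mono) simp
  then have "(K - (G ^ (p ^ k) oo fps_X ^ p)) oo fps_X ^ p \<in> fps_ploc p k"
    by (rule fps_ploc_compose_X_power)
  moreover have "(K - (G ^ (p ^ k) oo fps_X ^ p)) oo fps_X ^ p =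
    (K oo fps_X ^ p) - (G ^ (p ^ k) oo fps_X ^ (p ^ 2))"
    using p0 by (simp add: fps_compose_sub_distrib fps_compose_X_power_X_power power2_eq_square)
  moreover have "L \<in> fps_ploc p 2"
    unfolding L_def using fps_ploc_mult[OF fps_ploc_const[OF l] fps_ploc_mult[OF fps_ploc_X_power
      fps_ploc_compose_X_power[OF F]]]
    by simp
  ultimately have "L * ((K oo fps_X ^ p) - (G ^ (p ^ k) oo fps_X ^ (p ^ 2))) \<in> fps_ploc p (2 + k)"
    using fps_ploc_mult by metis
  then have 3: "(L * (K oo fps_X ^ p)) $ N - (L * (G ^ (p ^ k) oo fps_X ^ (p ^ 2))) $ N \<in>
    ploc p (Suc (Suc k))"
    by (auto dest: fps_plocD[where n = N] simp: right_diff_distrib)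
  have "L * (G ^ (p ^ k) oo fps_X ^ (p ^ 2)) =
    fps_const l * (fps_X ^ e * ((F * G ^ (p ^ k)) oo fps_X ^ (p ^ 2)))"
    using p0 by (simp add: L_def fps_compose_mult_distrib mult.assoc)
  then show ?thesis using ploc_add[OF 1[unfolded 2] 3] by simp
qed

text \<open>Each descent from N to M lowers k by 2 and is repaid by the factor p^2 of l.\<close>

lemma nth_mult_power_ploc:
  assumes "2 * Suc s \<le> k" "r < p" "r \<noteq> (e div p) mod p"
  shows "(F * G ^ (p ^ k)) $ (p ^ (2 * Suc s) * n + p ^ (2 * Suc s - 1) * r + offset p e s) \<in>
    ploc p k"
  using assms(1)
proof (induction s arbitrary: k)
  case 0
  have p0: "p > 0" using p by (rule prime_gt_0_nat)
  define j where "j = k - 2"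
  have k: "k = Suc (Suc j)" using 0 by (simp add: j_def)
  define N where "N = p ^ 2 * n + p * r + e mod p"
  have "N = e mod p + p * (p * n + r)" by (simp add: N_def power2_eq_square algebra_simps)
  then have N: "N mod p = e mod p" by (simp only: mod_mult_self2 mod_mod_trivial)
  \<comment> \<open>If p^2 divided N - e, comparing quotients by p would give r = e div p modulo p.
    Hence the right side of the congruence has no term at N.\<close>
  have ndvd: "\<not> p ^ 2 dvd N - e" if "e \<le> N"
  proof
    assume "p ^ 2 dvd N - e"
    then obtain M where "N - e = p ^ 2 * M" by (elim dvdE)
    with that have "N = p ^ 2 * M + e" by simp
    then have "p * (p * n + r) + e mod p = p * (p * M + e div p) + e mod p"
      by (simp add: N_def power2_eq_square algebra_simps)
    then have "p * n + r = p * M + e div p" using p0 by simp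
    then have "(p * n + r) mod p = (p * M + e div p) mod p" by simp
    then show False using assms(2,3) by simp
  qed
  have zero: "(fps_const l * (fps_X ^ e * ((F * G ^ (p ^ j)) oo fps_X ^ (p ^ 2)))) $ N = 0"
    using ndvd by (simp add: fps_X_power_mult_nth fps_nth_compose_X_power)
  have "(F * G ^ (p ^ Suc (Suc j))) $ N \<in> ploc p (Suc (Suc j))"
    using section_mult_power_cong[OF N, of j] by (simp only: zero diff_0_right)
  then show ?case by (simp add: k N_def)
next
  case (Suc s)
  define j where "j = k - 2"
  have k: "k = Suc (Suc j)" and j: "2 * Suc s \<le> j" using Suc.prems by (simp_all add: j_def)
  define M where "M = p ^ (2 * Suc s) * n + p ^ (2 * Suc s - 1) * r + offset p e s"
  define N where "N = p ^ 2 * M + e"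
  have N: "N = p ^ (2 * Suc (Suc s)) * n + p ^ (2 * Suc (Suc s) - 1) * r + offset p e (Suc s)"
    by (simp add: N_def M_def power2_eq_square algebra_simps)
  have "N mod p = e mod p" by (simp add: N_def power2_eq_square mult.assoc)
  from section_mult_power_cong[OF this, of j]
  have "(F * G ^ (p ^ k)) $ N - l * (F * G ^ (p ^ j)) $ M \<in> ploc p k"
    using prime_gt_0_nat[OF p] by (simp add: k N_def fps_X_power_mult_nth fps_nth_compose_X_power)
  moreover have "l * (F * G ^ (p ^ j)) $ M \<in> ploc p k"
    using ploc_mult[OF l Suc.IH[OF j]] by (simp add: k M_def)
  ultimately show ?case unfolding N[symmetric] using ploc_add by fastforce
qed

end

lemma p_frac_cong:
  assumes p: "prime p" and l: "l \<in> ploc p 2"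
    and sec: "fps_section p (e mod p) (euler_fn ^ m) =
      fps_const l * (fps_X ^ e * (euler_fn ^ m oo fps_X ^ (p ^ 2)))"
    and s: "s \<ge> 1" "2 * s \<le> k" and r: "r < p" "r \<noteq> (e div p) mod p" and b: "b > 0" "coprime b p"
  shows "rat_cong_0 (p_frac (- (of_nat p ^ k - of_nat m * of_nat b) / of_nat b)
    (p ^ (2 * s) * n + p ^ (2 * s - 1) * r + offset p e (s - 1))) (int p ^ k)"
proof -
  define g where "g = p_gen (- 1 / of_nat b)"
  have "- (of_nat p ^ k - of_nat m * of_nat b) / of_nat b =
    of_nat m * 1 + of_nat (p ^ k) * (- 1 / of_nat b :: rat)"
    using b by (simp add: field_simps)
  then have gen: "p_gen (- (of_nat p ^ k - of_nat m * of_nat b) / of_nat b) =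
    euler_fn ^ m * g ^ (p ^ k)"
    by (simp only: p_gen_add p_gen_of_nat_mult g_def)
  \<comment> \<open>With g = f^(-1/b) this is g^b f = 1, the input for the integrality of g.\<close>
  have "g ^ b * euler_fn = p_gen (of_nat b * (- 1 / of_nat b) + 1)"
    by (simp only: p_gen_add p_gen_of_nat_mult g_def)
  then have "g ^ b * euler_fn = 1" using b by (simp add: p_gen_0)
  moreover have "p_gen t $ 0 = 1" for t
    using p_gen_eq_below[of 0 t] by (simp add: fps_eq_below_def)
  ultimately have "g \<in> fps_ploc p 0"
    using b by (intro fps_ploc_root[OF euler_fn_ploc[of p]]) (simp_all add: g_def)
  moreover have "euler_fn ^ m \<in> fps_ploc p 0"
    using fps_ploc_power[OF euler_fn_ploc, of m p] by simp
  ultimately have "(euler_fn ^ m * g ^ (p ^ k)) $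
    (p ^ (2 * Suc (s - 1)) * n + p ^ (2 * Suc (s - 1) - 1) * r + offset p e (s - 1)) \<in> ploc p k"
    using s by (intro nth_mult_power_ploc[OF p _ _ l sec] r) simp_all
  then show ?thesis
    unfolding p_frac_def gen using s by (intro ploc_imp_rat_cong_0) simp
qed

text \<open>The forms cleared of denominators are proved by induction; they also show that the
  divisions are exact.\<close>

lemma offsets:
  assumes "s \<ge> 1"
  shows "offset 3 2 (s - 1) = (3 ^ (2 * s) - 1) div 4"
    and "offset 5 8 (s - 1) = (2 * 5 ^ (2 * s - 1) - 1) div 3"
    and "offset 5 14 (s - 1) = (11 * 5 ^ (2 * s - 1) - 7) div 12"
    and "offset 7 12 (s - 1) = (3 * 7 ^ (2 * s - 1) - 1) div 4"
proof -
  obtain j where s: "s = Suc j" using assms by (cases s) auto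
  have "4 * offset 3 2 j + 1 = 3 ^ (2 * s)" "3 * offset 5 8 j + 1 = 2 * 5 ^ (2 * s - 1)"
    "12 * offset 5 14 j + 7 = 11 * 5 ^ (2 * s - 1)" "4 * offset 7 12 j + 1 = 3 * 7 ^ (2 * s - 1)"
    unfolding s by (induction j; simp)+
  then show "offset 3 2 (s - 1) = (3 ^ (2 * s) - 1) div 4"
    and "offset 5 8 (s - 1) = (2 * 5 ^ (2 * s - 1) - 1) div 3"
    and "offset 5 14 (s - 1) = (11 * 5 ^ (2 * s - 1) - 7) div 12"
    and "offset 7 12 (s - 1) = (3 * 7 ^ (2 * s - 1) - 1) div 4"
    unfolding s by (simp_all flip: \<open>4 * offset 3 2 j + 1 = _\<close>)
qed

text \<open>The parameters (p, m, e, l) are (3, 6, 2, 9), (5, 8, 8, -125), (5, 14, 14, -15625) and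
  (7, 6, 12, 49). The residue omitted from each set for r is (e div p) mod p, namely 0, 1, 2,
  1.\<close>

theorem theorem1p9:
  fixes k s :: nat
  assumes "k > 1" and "s \<ge> 1" and "s \<le> k div 2"
  shows "(\<forall>n b r :: nat. b > 0 \<longrightarrow> coprime b 3 \<longrightarrow> r \<in> {1, 2} \<longrightarrow>
           rat_cong_0 (p_frac (- (3 ^ k - 6 * of_nat b) / of_nat b)
             (3 ^ (2 * s) * n + 3 ^ (2 * s - 1) * r + (3 ^ (2 * s) - 1) div 4)) (3 ^ k)) \<and>
      (\<forall>n b r :: nat. b > 0 \<longrightarrow> coprime b 5 \<longrightarrow> r \<in> {0, 2, 3, 4} \<longrightarrow>
           rat_cong_0 (p_frac (- (5 ^ k - 8 * of_nat b) / of_nat b)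
             (5 ^ (2 * s) * n + 5 ^ (2 * s - 1) * r + (2 * 5 ^ (2 * s - 1) - 1) div 3)) (5 ^ k)) \<and>
      (\<forall>n b r :: nat. b > 0 \<longrightarrow> coprime b 5 \<longrightarrow> r \<in> {0, 1, 3, 4} \<longrightarrow>
           rat_cong_0 (p_frac (- (5 ^ k - 14 * of_nat b) / of_nat b)
             (5 ^ (2 * s) * n + 5 ^ (2 * s - 1) * r + (11 * 5 ^ (2 * s - 1) - 7) div 12)) (5 ^ k)) \<and>
      (\<forall>n b r :: nat. b > 0 \<longrightarrow> coprime b 7 \<longrightarrow> r \<in> {0, 2, 3, 4, 5, 6} \<longrightarrow>
           rat_cong_0 (p_frac (- (7 ^ k - 6 * of_nat b) / of_nat b)
             (7 ^ (2 * s) * n + 7 ^ (2 * s - 1) * r + (3 * 7 ^ (2 * s - 1) - 1) div 4)) (7 ^ k))"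
proof (intro conjI allI impI)
  have s: "2 * s \<le> k" using assms(3) by linarith
  fix n b r :: nat
  assume b: "b > 0"
  show "rat_cong_0 (p_frac (- (3 ^ k - 6 * of_nat b) / of_nat b)
             (3 ^ (2 * s) * n + 3 ^ (2 * s - 1) * r + (3 ^ (2 * s) - 1) div 4)) (3 ^ k)"
    if "coprime b 3" "r \<in> {1, 2}"
  proof -
    have "(9 :: rat) \<in> ploc 3 2" using ploc_of_int[of 3 2 9] by simp
    then show ?thesis unfolding offsets(1)[OF assms(2), symmetric]
      using p_frac_cong[of 3 9 2 6 s k r b n] section_3_2_euler_fn_6 assms(2) s b that
      by auto
  qed
  show "rat_cong_0 (p_frac (- (5 ^ k - 8 * of_nat b) / of_nat b)
             (5 ^ (2 * s) * n + 5 ^ (2 * s - 1) * r + (2 * 5 ^ (2 * s - 1) - 1) div 3)) (5 ^ k)"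
    if "coprime b 5" "r \<in> {0, 2, 3, 4}"
  proof -
    have "(- 125 :: rat) \<in> ploc 5 2" using ploc_of_int[of 5 2 "- 125"] by simp
    then show ?thesis unfolding offsets(2)[OF assms(2), symmetric]
      using p_frac_cong[of 5 "- 125" 8 8 s k r b n] sections_5_euler_fn(1) assms(2) s b that
      by auto
  qed
  show "rat_cong_0 (p_frac (- (5 ^ k - 14 * of_nat b) / of_nat b)
             (5 ^ (2 * s) * n + 5 ^ (2 * s - 1) * r + (11 * 5 ^ (2 * s - 1) - 7) div 12)) (5 ^ k)"
    if "coprime b 5" "r \<in> {0, 1, 3, 4}"
  proof -
    have "(- 15625 :: rat) \<in> ploc 5 2" using ploc_of_int[of 5 2 "- 15625"] by simp
    then show ?thesis unfolding offsets(3)[OF assms(2), symmetric]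
      using p_frac_cong[of 5 "- 15625" 14 14 s k r b n] sections_5_euler_fn(2) assms(2) s b that
      by auto
  qed
  show "rat_cong_0 (p_frac (- (7 ^ k - 6 * of_nat b) / of_nat b)
             (7 ^ (2 * s) * n + 7 ^ (2 * s - 1) * r + (3 * 7 ^ (2 * s - 1) - 1) div 4)) (7 ^ k)"
    if "coprime b 7" "r \<in> {0, 2, 3, 4, 5, 6}"
  proof -
    have "(49 :: rat) \<in> ploc 7 2" using ploc_of_int[of 7 2 49] by simp
    then show ?thesis unfolding offsets(4)[OF assms(2), symmetric]
      using p_frac_cong[of 7 49 12 6 s k r b n] section_7_5_euler_fn_6 assms(2) s b that
      by auto
  qed
qed

end
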